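(* There is an absolute constant $K$ such that for every $n\ge2$, all distinct real numbers $w_1,\dots,w_n$ and all distinct real numbers $v_1,\dots,v_n$ (where $w_i=v_j$ is allowed for some $i,j$), $$\sup_{x\in\mathbb{R}}\mathbb{P}\Big(\sum_{i=1}^n w_iv_{\pi(i)}=x\Big)\le\frac{K\log n}{n^{5/2}},$$ where $\pi$ is a uniformly random permutation of $\{1,\dots,n\}$. *)

theory Defs
  imports "HOL-Probability.Probability" "HOL-Combinatorics.Permutations"
begin

definition uniform_perm :: "nat \<Rightarrow> (nat \<Rightarrow> nat) pmf" where
  "uniform_perm n = pmf_of_set {\<pi>. \<pi> permutes {1..n}}"

end

(*
  Write pi = rho o h o inv sigma with sigma, rho uniformly random and h a random product of
  the disjoint transpositions (2k+1, 2k+2).  Given sigma and rho, the sum is a constant minus a sum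
  of independent terms, the k-th being 0 or c_k = (w a - w b)(v c - v d), where a, b, c, d are the
  images of 2k+1, 2k+2 under sigma and rho.

  The factor n^-2.  The sum of about log^2 n independent copies of c_k takes no value with
  probability more than C/n^2 (replacing sigma and rho by independent uniform indices at these few
  positions costs a constant factor).  This is bootstrapped with a weighted Szemeredi-Trotter bound for
  Cartesian products, read off the equation a b + y + z = x as incidences of points (a, y) with
  lines (b, z): if the largest atom is t^3/n^2 for r terms, it is at most 19 t^2/n^2 for 2r+1 terms.
  Hence a half-block of that many coin flips has expected collision probability O(n^-2), and by
  Cauchy-Schwarz two half-blocks together form a block whose atoms are O(n^-2) on average.

  The factor n^(-1/2).  The roughly n/log^2 n blocks are independent, and a sum of N independent
  real variables with atoms at most q has atoms O(q/sqrt N).  This is Kesten's inequality, proved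
  here by a rearrangement: the largest mass of a set of given size is at most that for a sum of
  uniform variables on an arithmetic progression, which splits into a binomial part, giving
  1/sqrt N, and a part equidistributed modulo h, giving q.
*)
theory Submission
  imports Defs "HOL-Real_Asymp.Real_Asymp"
begin

section \<open>Sums of independent random variables\<close>

text \<open>Given sigma and rho, the coin sum has to hit a target that itself depends on sigma and
  rho. So it is not enough to average the atom at a fixed point: the average of the largest atom is
  needed. Collision probabilities provide it. They control the atoms at all points at once, and
  their mean is the probability that a signed sum of the \<open>c_k\<close> vanishes, an event about
  the fixed value 0. The final bound is linear in them, so the dependence between blocks through
  sigma and rho is harmless.

  The logarithm arises as follows. One bootstrap round turns an excess factor \<open>t^3\<close>
  over \<open>1/n^2\<close> into \<open>19 t^2\<close>, essentially its power 2/3, and doubles the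
  number of terms. About \<open>2 log2 (ln n)\<close> rounds bring the initial factor
  \<open>2 n\<close> down to a constant, hence about \<open>(ln n)^2\<close> terms per block. The
  resulting \<open>n / (ln n)^2\<close> blocks gain the reciprocal of the square root of their
  number, which is \<open>ln n / sqrt n\<close>.\<close>

lemma prob_pair_pmf:
  "measure_pmf.prob (pair_pmf A B) S = measure_pmf.expectation A (\<lambda>a. measure_pmf.prob B {b. (a, b) \<in> S})"
proof -
  have "measure_pmf.prob (pair_pmf A B) S = pmf (map_pmf (\<lambda>z. z \<in> S) (pair_pmf A B)) True"
    by (simp add: pmf_map vimage_def)
  also have "map_pmf (\<lambda>z. z \<in> S) (pair_pmf A B) = bind_pmf A (\<lambda>a. map_pmf (\<lambda>b. (a, b) \<in> S) B)"
    by (simp add: pair_pmf_def map_bind_pmf map_pmf_def bind_assoc_pmf bind_return_pmf)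
  also have "pmf \<dots> True = measure_pmf.expectation A (\<lambda>a. measure_pmf.prob B {b. (a, b) \<in> S})"
    by (simp add: pmf_bind pmf_map vimage_def)
  finally show ?thesis .
qed

lemma expectation_prob_commute:
  "measure_pmf.expectation A (\<lambda>a. measure_pmf.prob B {b. R a b}) =
   measure_pmf.expectation B (\<lambda>b. measure_pmf.prob A {a. R a b})"
proof -
  have "measure_pmf.prob (pair_pmf A B) {(a, b). R a b} = measure_pmf.prob (pair_pmf B A) {(b, a). R a b}"
    by (subst pair_commute_pmf) (auto intro!: arg_cong2[where f=measure_pmf.prob] simp: vimage_def)
  then show ?thesis by (simp add: prob_pair_pmf)
qed

lemma expectation_finite_pmf:
  fixes f :: "'a \<Rightarrow> real"
  assumes "finite (set_pmf A)"
  shows "measure_pmf.expectation A f = (\<Sum>a\<in>set_pmf A. pmf A a * f a)"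
  using assms by (subst integral_measure_pmf[of "set_pmf A"]) (auto simp: scaleR_conv_of_real)

lemma expectation_le_const:
  fixes f :: "'a \<Rightarrow> real"
  assumes "finite (set_pmf A)" "\<And>a. a \<in> set_pmf A \<Longrightarrow> f a \<le> c"
  shows "measure_pmf.expectation A f \<le> c"
proof -
  have "measure_pmf.expectation A f \<le> (\<Sum>a\<in>set_pmf A. pmf A a * c)"
    unfolding expectation_finite_pmf[OF assms(1)] by (intro sum_mono mult_left_mono assms) auto
  also have "\<dots> = c"
    using assms(1) by (simp add: sum_distrib_right[symmetric] sum_pmf_eq_1)
  finally show ?thesis .
qed

lemma expectation_mono_pmf:
  fixes f g :: "'a \<Rightarrow> real"
  assumes "finite (set_pmf A)" "\<And>a. a \<in> set_pmf A \<Longrightarrow> f a \<le> g a"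
  shows "measure_pmf.expectation A f \<le> measure_pmf.expectation A g"
  unfolding expectation_finite_pmf[OF assms(1)] by (intro sum_mono mult_left_mono assms) auto

definition conv_pmf :: "real pmf \<Rightarrow> real pmf \<Rightarrow> real pmf" where
  "conv_pmf A B = map_pmf (\<lambda>(a, b). a + b) (pair_pmf A B)"

lemma finite_conv_pmf [simp]:
  "finite (set_pmf A) \<Longrightarrow> finite (set_pmf B) \<Longrightarrow> finite (set_pmf (conv_pmf A B))"
  by (simp add: conv_pmf_def)

lemma prob_conv_pmf:
  "measure_pmf.prob (conv_pmf A B) S = measure_pmf.expectation A (\<lambda>a. measure_pmf.prob B {b. a + b \<in> S})"
  by (simp add: conv_pmf_def prob_pair_pmf)

lemma pmf_conv_pmf: "pmf (conv_pmf A B) x = measure_pmf.expectation A (\<lambda>a. pmf B (x - a))"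
proof -
  have "{b. a + b = x} = {x - a}" for a by auto
  then show ?thesis
    using prob_conv_pmf[of A B "{x}"] by (simp add: measure_pmf_single)
qed

lemma conv_pmf_commute: "conv_pmf A B = conv_pmf B A"
  unfolding conv_pmf_def by (subst pair_commute_pmf) (simp add: pmf.map_comp o_def case_prod_unfold add.commute)

lemma conv_pmf_assoc: "conv_pmf (conv_pmf A B) C = conv_pmf A (conv_pmf B C)"
  unfolding conv_pmf_def pair_map_pmf1 pair_map_pmf2 pair_pair_pmf
  by (simp add: pmf.map_comp o_def case_prod_beta add.assoc)

lemma conv_pmf_return_0 [simp]: "conv_pmf (return_pmf 0) A = A"
  by (simp add: conv_pmf_def pair_return_pmf1 pmf.map_comp o_def)

lemma conv_pmf_return_0_right [simp]: "conv_pmf A (return_pmf 0) = A"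
  using conv_pmf_return_0 by (simp only: conv_pmf_commute)

lemma pmf_conv_pmf_le:
  assumes "finite (set_pmf A)" "\<And>x. pmf B x \<le> c"
  shows "pmf (conv_pmf A B) x \<le> c"
  unfolding pmf_conv_pmf by (intro expectation_le_const assms)

definition sum_pmf :: "'i set \<Rightarrow> ('i \<Rightarrow> real pmf) \<Rightarrow> real pmf" where
  "sum_pmf I X = map_pmf (\<lambda>f. \<Sum>i\<in>I. f i) (Pi_pmf I 0 X)"

lemma map_pmf_Pi_pmf_sum_insert:
  assumes "finite I" "k \<notin> I"
  shows "map_pmf (\<lambda>f. \<Sum>i\<in>insert k I. g i (f i)) (Pi_pmf (insert k I) d X) =
    conv_pmf (map_pmf (g k) (X k)) (map_pmf (\<lambda>f. \<Sum>i\<in>I. g i (f i)) (Pi_pmf I d X))"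
proof -
  have *: "(\<Sum>i\<in>I. g i (if i = k then a else f i)) = (\<Sum>i\<in>I. g i (f i))" for a f
    using assms by (intro sum.cong) auto
  show ?thesis
    using assms by (simp add: Pi_pmf_insert conv_pmf_def pmf.map_comp o_def case_prod_beta *
        pair_map_pmf1 pair_map_pmf2 apfst_def apsnd_def map_prod_def)
qed

lemma sum_pmf_empty [simp]: "sum_pmf {} X = return_pmf 0"
  by (simp add: sum_pmf_def)

lemma sum_pmf_insert:
  "finite I \<Longrightarrow> k \<notin> I \<Longrightarrow> sum_pmf (insert k I) X = conv_pmf (X k) (sum_pmf I X)"
  unfolding sum_pmf_def using map_pmf_Pi_pmf_sum_insert[of I k "\<lambda>_ x. x" 0 X] by simp

lemma map_pmf_Pi_pmf_sum:
  assumes "finite I"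
  shows "map_pmf (\<lambda>f. \<Sum>i\<in>I. g i (f i)) (Pi_pmf I d X) = sum_pmf I (\<lambda>i. map_pmf (g i) (X i))"
  using assms
  by (induction I) (simp_all add: map_pmf_Pi_pmf_sum_insert sum_pmf_insert del: sum.insert)

lemma sum_pmf_cong: "(\<And>i. i \<in> I \<Longrightarrow> X i = Y i) \<Longrightarrow> sum_pmf I X = sum_pmf I Y"
  unfolding sum_pmf_def by (intro arg_cong[where f="map_pmf _"] Pi_pmf_cong) auto

lemma sum_pmf_Un:
  assumes "finite I" "finite J" "I \<inter> J = {}"
  shows "sum_pmf (I \<union> J) X = conv_pmf (sum_pmf I X) (sum_pmf J X)"
  using assms by (induction I) (simp_all add: sum_pmf_insert conv_pmf_assoc)

lemma sum_pmf_UN: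
  assumes "finite I" "\<And>i. i \<in> I \<Longrightarrow> finite (A i)" "disjoint_family_on A I"
  shows "sum_pmf (\<Union>i\<in>I. A i) X = sum_pmf I (\<lambda>i. sum_pmf (A i) X)"
  using assms
proof (induction I)
  case (insert k I)
  have "A k \<inter> (\<Union>i\<in>I. A i) = {}"
    using insert.prems insert.hyps by (fastforce simp: disjoint_family_on_def)
  moreover have "disjoint_family_on A I"
    using insert.prems by (simp add: disjoint_family_on_def)
  ultimately show ?case
    using insert by (simp add: sum_pmf_insert sum_pmf_Un)
qed simp

lemma finite_sum_pmf [simp]:
  "finite I \<Longrightarrow> (\<And>i. i \<in> I \<Longrightarrow> finite (set_pmf (X i))) \<Longrightarrow> finite (set_pmf (sum_pmf I X))"
  by (induction I rule: finite_induct) (simp_all add: sum_pmf_insert)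

section \<open>Kesten's inequality\<close>

lemma top_subset_exists:
  fixes g :: "'a \<Rightarrow> real"
  assumes "finite F" "m \<le> card F"
  shows "\<exists>X\<subseteq>F. card X = m \<and> (\<forall>x\<in>X. \<forall>y\<in>F - X. g y \<le> g x)"
  using assms(2)
proof (induction m)
  case (Suc m)
  then obtain X where X: "X \<subseteq> F" "card X = m" "\<forall>x\<in>X. \<forall>y\<in>F - X. g y \<le> g x" by auto
  have fin: "finite X" using X assms(1) finite_subset by blast
  have "F - X \<noteq> {}" using X Suc.prems card_mono[OF fin, of F] by auto
  then have "Max (g ` (F - X)) \<in> g ` (F - X)"
    using assms(1) by (intro Max_in) auto
  then obtain y where y: "y \<in> F - X" "\<forall>z\<in>F - X. g z \<le> g y"
    using assms(1) by (metis Max_ge finite_Diff finite_imageI imageE image_eqI)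
  show ?case
    by (rule exI[of _ "insert y X"]) (use X y fin in auto)
qed auto

text \<open>Bathtub principle: with every atom capped at \<open>1 / m\<close>, the expectation is
  largest when the mass is spread evenly over \<open>m\<close> top values of \<open>g\<close>. This
  reduces Kesten's inequality to uniform summands.\<close>

lemma expectation_le_average_on_top:
  fixes g :: "'a \<Rightarrow> real"
  assumes fin: "finite (set_pmf R)" and m: "m > 0" and atom: "\<And>x. pmf R x \<le> 1 / real m"
  shows "\<exists>X. finite X \<and> card X = m \<and> measure_pmf.expectation R g \<le> (\<Sum>x\<in>X. g x) / real m"
proof -
  let ?F = "set_pmf R"
  have "1 = (\<Sum>x\<in>?F. pmf R x)" using fin by (simp add: sum_pmf_eq_1)
  also have "\<dots> \<le> (\<Sum>x\<in>?F. 1 / real m)" by (intro sum_mono atom)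
  finally have "m \<le> card ?F" using m by (simp add: field_simps)
  from top_subset_exists[OF fin this] obtain X where
    X: "X \<subseteq> ?F" "card X = m" "\<And>x y. x \<in> X \<Longrightarrow> y \<in> ?F - X \<Longrightarrow> g y \<le> g x" by metis
  have finX: "finite X" using X(1) fin finite_subset by blast
  have neX: "X \<noteq> {}" using X m by auto
  \<comment> \<open>\<open>t\<close> separates the values of \<open>g\<close> on \<open>X\<close>
    from those off \<open>X\<close>. The mass off \<open>X\<close> equals the total deficit
    \<open>1 / m - pmf R x\<close> over \<open>X\<close>, so it can be moved there without lowering
    the expectation.\<close>
  define t where "t = Min (g ` X)"
  have t1: "t \<le> g x" if "x \<in> X" for x using that finX by (simp add: t_def)
  have "t \<in> g ` X" unfolding t_def by (rule Min_in) (use finX neX in auto)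
  then have t2: "g y \<le> t" if "y \<in> ?F - X" for y using X(3) that by auto
  have "measure_pmf.expectation R g = (\<Sum>x\<in>X. pmf R x * g x) + (\<Sum>x\<in>?F - X. pmf R x * g x)"
    unfolding expectation_finite_pmf[OF fin] using sum.subset_diff[OF X(1) fin] by (simp add: add.commute)
  also have "(\<Sum>x\<in>?F - X. pmf R x * g x) \<le> (\<Sum>x\<in>?F - X. pmf R x * t)"
    by (intro sum_mono mult_left_mono t2) auto
  also have "\<dots> = (1 - (\<Sum>x\<in>X. pmf R x)) * t"
    using sum.subset_diff[OF X(1) fin, of "pmf R"] fin
    by (simp add: sum_distrib_right[symmetric] sum_pmf_eq_1)
  also have "1 - (\<Sum>x\<in>X. pmf R x) = (\<Sum>x\<in>X. 1 / real m - pmf R x)"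
    using X(2) m by (simp add: sum_subtractf)
  also have "\<dots> * t \<le> (\<Sum>x\<in>X. (1 / real m - pmf R x) * g x)"
    unfolding sum_distrib_right by (intro sum_mono mult_left_mono t1) (use atom in auto)
  finally have "measure_pmf.expectation R g \<le> (\<Sum>x\<in>X. g x) / real m"
    by (simp add: algebra_simps sum_divide_distrib sum_subtractf sum.distrib)
  then show ?thesis using X finX by blast
qed

text \<open>One hook consists of the sums of \<open>Min K\<close> with \<open>X\<close> and of \<open>K\<close> with \<open>Max X\<close>; these are pairwise
  distinct.  Removing the hook leaves a sumset of the same shape.\<close>
lemma sum_sumset_le_hooks:
  fixes p :: "real \<Rightarrow> real" and D :: "nat \<Rightarrow> real"
  assumes "finite K" "finite X" "card K = k" "card X = m"
    and D: "\<And>T. finite T \<Longrightarrow> (\<Sum>s\<in>T. p s) \<le> D (card T)"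
  shows "(\<Sum>s\<in>K. \<Sum>x\<in>X. p (s + x)) \<le> (\<Sum>i<min k m. D (k + m - 1 - 2 * i))"
  using assms(1-4)
proof (induction k arbitrary: K X m)
  case 0
  then show ?case by simp
next
  case (Suc k)
  show ?case
  proof (cases m)
    case 0
    then show ?thesis using Suc.prems by simp
  next
    case (Suc m')
    have neK: "K \<noteq> {}" and neX: "X \<noteq> {}" using Suc Suc.prems by auto
    define a where "a = Min K"
    define b where "b = Max X"
    have a: "a \<in> K" "\<And>s. s \<in> K \<Longrightarrow> a \<le> s" unfolding a_def using Suc.prems neK by auto
    have b: "b \<in> X" "\<And>s. s \<in> X \<Longrightarrow> s \<le> b" unfolding b_def using Suc.prems neX by auto
    let ?K = "K - {a}" and ?X = "X - {b}"
    let ?T1 = "(\<lambda>x. a + x) ` X" and ?T2 = "(\<lambda>s. s + b) ` ?K"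
    have disj: "?T1 \<inter> ?T2 = {}"
    proof (rule ccontr)
      assume "?T1 \<inter> ?T2 \<noteq> {}"
      then obtain x s where "x \<in> X" "s \<in> ?K" "a + x = s + b" by auto
      with a(2)[of s] b(2)[of x] show False by force
    qed
    have inj: "inj_on (\<lambda>x. a + x) X" "inj_on (\<lambda>s. s + b) ?K" by (auto simp: inj_on_def)
    have cK: "card ?K = k" "card ?X = m'" using a b Suc Suc.prems by auto
    have "(\<Sum>s\<in>?T1 \<union> ?T2. p s) \<le> D (card (?T1 \<union> ?T2))"
      by (intro D) (use Suc.prems in auto)
    also have "card (?T1 \<union> ?T2) = Suc k + m - 1"
      using disj inj cK Suc.prems by (simp add: card_Un_disjoint card_image)
    also have "(\<Sum>s\<in>?T1 \<union> ?T2. p s) = (\<Sum>x\<in>X. p (a + x)) + (\<Sum>s\<in>?K. p (s + b))"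
      using disj inj Suc.prems by (simp add: sum.union_disjoint sum.reindex)
    finally have hook: "(\<Sum>x\<in>X. p (a + x)) + (\<Sum>s\<in>?K. p (s + b)) \<le> D (Suc k + m - 1)" .
    have "(\<Sum>s\<in>K. \<Sum>x\<in>X. p (s + x)) = (\<Sum>x\<in>X. p (a + x)) + (\<Sum>s\<in>?K. \<Sum>x\<in>X. p (s + x))"
      using a Suc.prems by (simp add: sum.remove[of K a])
    also have "(\<Sum>s\<in>?K. \<Sum>x\<in>X. p (s + x)) = (\<Sum>s\<in>?K. p (s + b)) + (\<Sum>s\<in>?K. \<Sum>x\<in>?X. p (s + x))"
      using b Suc.prems by (simp add: sum.remove[of X b] sum.distrib)
    also have "(\<Sum>s\<in>?K. \<Sum>x\<in>?X. p (s + x)) \<le> (\<Sum>i<min k m'. D (k + m' - 1 - 2 * i))"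
      by (intro Suc.IH) (use Suc.prems cK in auto)
    also have "\<dots> = (\<Sum>i<min k m'. D (Suc k + m - 1 - 2 * Suc i))"
      using Suc by (intro sum.cong refl arg_cong[where f=D]) auto
    finally have "(\<Sum>s\<in>K. \<Sum>x\<in>X. p (s + x)) \<le>
        D (Suc k + m - 1 - 2 * 0) + (\<Sum>i<min k m'. D (Suc k + m - 1 - 2 * Suc i))"
      using hook by simp
    also have "\<dots> = (\<Sum>i<Suc (min k m'). D (Suc k + m - 1 - 2 * i))"
      by (simp only: sum.lessThan_Suc_shift)
    also have "Suc (min k m') = min (Suc k) m" using Suc by simp
    finally show ?thesis .
  qed
qed

section \<open>Extremal sums: uniform variables on an arithmetic progression\<close>

lemma sum_pmf_conv:
  assumes "finite I"
  shows "sum_pmf I (\<lambda>i. conv_pmf (X i) (Y i)) = conv_pmf (sum_pmf I X) (sum_pmf I Y)"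
  using assms
proof (induction I)
  case (insert k I)
  have "conv_pmf (conv_pmf a b) (conv_pmf c d) = conv_pmf (conv_pmf a c) (conv_pmf b d)" for a b c d
    by (metis conv_pmf_assoc conv_pmf_commute)
  then show ?case using insert by (simp add: sum_pmf_insert)
qed simp

text \<open>Integer form of the bound \<open>1 / sqrt (2 * k + 1)\<close> for the middle binomial
  probability. The induction closes because
  \<open>(2 * k + 1) * (2 * k + 3) <= (2 * k + 2)^2\<close>.\<close>

lemma central_binomial_even_le: "((2 * k) choose k)\<^sup>2 * (2 * k + 1) \<le> (16::nat) ^ k"
proof (induction k)
  case (Suc k)
  let ?c = "(2 * k) choose k" and ?d = "(2 * Suc k) choose Suc k"
  have eq: "Suc k * ?d = 2 * (2 * k + 1) * ?c"
  proof -
    have "Suc k * ?d = Suc (2 * k + 1) * ((2 * k + 1) choose k)"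
      using Suc_times_binomial_eq[of "2 * k + 1" k] by (simp add: mult.commute)
    moreover have "Suc k * ((2 * k + 1) choose Suc k) = (2 * k + 1) * ?c"
      using Suc_times_binomial_eq[of "2 * k" k] by (simp add: mult.commute)
    moreover have "(2 * k + 1) choose Suc k = (2 * k + 1) choose k"
      by (subst binomial_symmetric) auto
    ultimately show ?thesis by (simp add: algebra_simps)
  qed
  have "(Suc k)\<^sup>2 * (?d\<^sup>2 * (2 * Suc k + 1)) = (Suc k * ?d)\<^sup>2 * (2 * k + 3)"
    by (simp add: power2_eq_square algebra_simps)
  also have "\<dots> = 4 * (?c\<^sup>2 * (2 * k + 1)) * ((2 * k + 1) * (2 * k + 3))"
    unfolding eq by (simp add: power2_eq_square algebra_simps)
  also have "\<dots> \<le> 4 * 16 ^ k * (4 * (Suc k)\<^sup>2)"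
  proof -
    have "(2 * k + 1) * (2 * k + 3) \<le> 4 * (Suc k)\<^sup>2" by (simp add: power2_eq_square algebra_simps)
    then show ?thesis by (intro mult_le_mono[OF mult_le_mono2[OF Suc]])
  qed
  finally have "(Suc k)\<^sup>2 * (?d\<^sup>2 * (2 * Suc k + 1)) \<le> (Suc k)\<^sup>2 * 16 ^ Suc k"
    by simp
  then show ?case by simp
qed simp

lemma binomial_le_power_div_sqrt:
  assumes "n > 0"
  shows "real (n choose k) / 2 ^ n \<le> 1 / sqrt (real n)"
proof -
  have "(n choose (n div 2))\<^sup>2 * n \<le> 4 ^ n"
  proof (cases "even n")
    case True
    then obtain l where l: "n = 2 * l" by blast
    have "((2 * l) choose l)\<^sup>2 * (2 * l) \<le> 16 ^ l"
      using central_binomial_even_le[of l] by (simp add: algebra_simps)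
    then show ?thesis using l by (simp add: power_mult)
  next
    case False
    then obtain l where l: "n = 2 * l + 1" using oddE by blast
    \<comment> \<open>For odd \<open>n\<close> the middle coefficient is half of the next even one,
      which reduces this case to the even estimate.\<close>
    have "(2 * l + 1) choose Suc l = (2 * l + 1) choose l"
      by (subst binomial_symmetric) auto
    then have eq: "(2 * Suc l) choose Suc l = 2 * ((2 * l + 1) choose l)" by simp
    have "4 * (((2 * l + 1) choose l)^2 * (2 * l + 1)) \<le> ((2 * Suc l) choose Suc l)^2 * (2 * Suc l + 1)"
      unfolding eq power_mult_distrib by simp
    also have "\<dots> \<le> 16 ^ Suc l" by (rule central_binomial_even_le)
    finally show ?thesis using l by (simp add: power_mult)
  qed
  moreover have "(n choose k) \<le> (n choose (n div 2))" by (rule binomial_maximum)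
  ultimately have "(n choose k)\<^sup>2 * n \<le> 4 ^ n"
    by (meson le_trans mult_le_mono1 power_mono zero_le)
  then have "real ((n choose k)\<^sup>2 * n) \<le> real (4 ^ n)" by (simp only: of_nat_le_iff)
  moreover have "(4::real) ^ n = (2 ^ n)^2"
    by (simp add: power2_eq_square power_mult_distrib[symmetric])
  ultimately have "(real (n choose k) * sqrt n)^2 \<le> (2 ^ n)^2"
    by (simp add: power_mult_distrib)
  then have "real (n choose k) * sqrt n \<le> 2 ^ n"
    by (rule power2_le_imp_le) simp
  then show ?thesis using assms by (simp add: field_simps)
qed

text \<open>Uniform on \<open>2 * h\<close> points with spacing 2 centred at 0, so that a window around 0 of the right
  parity plays the role of the heaviest set of a given size.\<close>
definition step_pmf :: "nat \<Rightarrow> real pmf" where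
  "step_pmf h = map_pmf (\<lambda>u. 2 * real u - (2 * real h - 1)) (pmf_of_set {..<2 * h})"

text \<open>For fixed \<open>s\<close>, the hook windows around 0 that contain \<open>s\<close> are
  injected into the steps \<open>u\<close> that carry \<open>s\<close> into the window of half-width
  \<open>k\<close>. This lets the hook estimate be reassembled into a single window for a longer
  sum.\<close>

lemma card_hooks_le_card_steps:
  fixes s :: real and k m :: nat
  defines "\<kappa> \<equiv> \<lambda>i. real (k + m - 1 - 2 * i)"
  shows "card {i. i < min k m \<and> - \<kappa> i < s \<and> s \<le> \<kappa> i} \<le>
         card {u. u < m \<and> - real k < s + (2 * real u - (real m - 1)) \<and> s + (2 * real u - (real m - 1)) \<le> real k}"
    (is "card ?I \<le> card ?U")
proof (rule card_inj_on_le)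
  \<comment> \<open>The steps landing in the window are the integers from
    \<open>max 0 (A - k + 1)\<close> to \<open>min (m - 1) A\<close>; \<open>f\<close> counts
    upwards from the lower end.\<close>
  define A where "A = \<lfloor>(real k + real m - 1 - s) / 2\<rfloor>"
  define f where "f = (\<lambda>i. nat (max 0 (A - int k + 1) + int i))"
  show "inj_on f ?I" by (auto simp: f_def inj_on_def)
  show "finite ?U" by simp
  show "f ` ?I \<subseteq> ?U"
  proof (rule image_subsetI)
    fix i assume "i \<in> ?I"
    then have i: "i < k" "i < m" "- \<kappa> i < s" "s \<le> \<kappa> i" by auto
    have A: "real_of_int A \<le> (real k + real m - 1 - s) / 2" "(real k + real m - 1 - s) / 2 < real_of_int A + 1"
      unfolding A_def by linarith+
    have \<kappa>: "\<kappa> i = real k + real m - 1 - 2 * real i"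
      using i by (simp add: \<kappa>_def)
    have iA: "int i \<le> A" using i(4) unfolding \<kappa> A_def by (simp add: le_floor_iff)
    have "real_of_int (int i) < real_of_int (int k + int m - 1 - A)"
      using i(3) A unfolding \<kappa> by simp
    then have iA2: "int i \<le> int k + int m - 2 - A" by linarith
    define u where "u = f i"
    have u: "int u = max 0 (A - int k + 1) + int i" by (simp add: u_def f_def)
    have "int u < int m" "int u \<le> A" "A - int k + 1 \<le> int u"
      using iA iA2 i unfolding u by auto
    then have "u < m" "real u \<le> real_of_int A" "real_of_int A - real k + 1 \<le> real u" by linarith+
    then show "f i \<in> ?U" using A unfolding u_def[symmetric] by auto
  qed
qed

lemma finite_step_pmf [simp]: "h > 0 \<Longrightarrow> finite (set_pmf (step_pmf h))"
  by (simp add: step_pmf_def lessThan_empty_iff)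

lemma prob_as_sum:
  assumes "finite (set_pmf S)"
  shows "measure_pmf.prob S W = (\<Sum>s\<in>set_pmf S. pmf S s * (if s \<in> W then 1 else 0))"
proof -
  have "measure_pmf.prob S W = measure_pmf.expectation S (indicator W)" by simp
  also have "\<dots> = (\<Sum>s\<in>set_pmf S. pmf S s * indicator W s)"
    by (rule expectation_finite_pmf[OF assms])
  finally show ?thesis by (simp add: indicator_def of_bool_def)
qed

lemma sum_if_eq_card: "finite A \<Longrightarrow> (\<Sum>i\<in>A. if P i then 1 else 0 :: real) = real (card {i. i \<in> A \<and> P i})"
  by (simp add: sum.If_cases Int_def)

text \<open>The injection averaged over \<open>s\<close>: the windows that come from the hooks,
  divided by \<open>m\<close>, are absorbed by one further uniform step.\<close>

lemma step_window_recursion: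
  assumes h: "h > 0" and S: "finite (set_pmf S)"
  defines "m \<equiv> 2 * h"
  shows "(\<Sum>i<min k m. measure_pmf.prob S {- real (k + m - 1 - 2 * i) <.. real (k + m - 1 - 2 * i)}) / real m
     \<le> measure_pmf.prob (conv_pmf (step_pmf h) S) {- real k <.. real k}"
proof -
  let ?w = "\<lambda>i s. - real (k + m - 1 - 2 * i) < s \<and> s \<le> real (k + m - 1 - 2 * i)"
  let ?v = "\<lambda>u s. - real k < s + (2 * real u - (real m - 1)) \<and> s + (2 * real u - (real m - 1)) \<le> real k"
  have "(\<Sum>i<min k m. measure_pmf.prob S {- real (k + m - 1 - 2 * i) <.. real (k + m - 1 - 2 * i)})
      = (\<Sum>i<min k m. \<Sum>s\<in>set_pmf S. pmf S s * (if ?w i s then 1 else 0))"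
    by (simp add: prob_as_sum[OF S])
  also have "\<dots> = (\<Sum>s\<in>set_pmf S. pmf S s * (\<Sum>i<min k m. if ?w i s then 1 else 0))"
    by (subst sum.swap) (simp add: sum_distrib_left)
  also have "\<dots> = (\<Sum>s\<in>set_pmf S. pmf S s * real (card {i. i < min k m \<and> ?w i s}))"
    by (simp only: sum_if_eq_card[OF finite_lessThan] lessThan_iff)
  also have "\<dots> \<le> (\<Sum>s\<in>set_pmf S. pmf S s * real (card {u. u < m \<and> ?v u s}))"
    by (intro sum_mono mult_left_mono) (use card_hooks_le_card_steps[of k m] in auto)
  also have "\<dots> = real m * measure_pmf.expectation S (\<lambda>s. real (card {u. u < m \<and> ?v u s}) / real m)"
    using h S by (simp add: expectation_finite_pmf sum_divide_distrib[symmetric] m_def)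
  also have "measure_pmf.expectation S (\<lambda>s. real (card {u. u < m \<and> ?v u s}) / real m) =
      measure_pmf.prob (conv_pmf S (step_pmf h)) {- real k <.. real k}"
  proof -
    have "{..<m} \<inter> {u. ?v u s} = {u. u < m \<and> ?v u s}" for s by auto
    then show ?thesis
      using h unfolding prob_conv_pmf step_pmf_def m_def
      by (simp add: vimage_def measure_pmf_of_set lessThan_empty_iff add_diff_eq)
  qed
  finally show ?thesis
    using h by (simp add: conv_pmf_commute m_def field_simps)
qed

text \<open>Induction on the summands: the new summand is replaced by a uniform variable on
  \<open>2 * h\<close> points, the resulting sumset is cut into hooks, each hook is bounded by the
  induction hypothesis as an arbitrary set of its size, and the windows recombine. The claim is
  about all finite \<open>K\<close> and not only about atoms because the hooks are larger
  sets.\<close>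

lemma prob_sum_pmf_le_step:
  assumes h: "h > 0" and J: "finite J"
    and X: "\<And>j. j \<in> J \<Longrightarrow> finite (set_pmf (X j))" "\<And>j x. j \<in> J \<Longrightarrow> pmf (X j) x \<le> 1 / real (2 * h)"
    and K: "finite K"
  shows "measure_pmf.prob (sum_pmf J X) K \<le>
     measure_pmf.prob (sum_pmf J (\<lambda>_. step_pmf h)) {- real (card K) <.. real (card K)}"
  using J X K
proof (induction J arbitrary: K)
  case empty
  show ?case
  proof (cases "K = {}")
    case False
    then have "card K > 0" using empty by (simp add: card_gt_0_iff)
    then show ?thesis by (simp add: indicator_def)
  qed simp
next
  case (insert j J)
  let ?S = "sum_pmf J X" and ?R = "sum_pmf J (\<lambda>_. step_pmf h)" and ?m = "2 * h"
  let ?D = "\<lambda>t. measure_pmf.prob ?R {- real t <.. real t}"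
  let ?g = "\<lambda>x. measure_pmf.prob ?S {b. x + b \<in> K}"
  have "measure_pmf.prob (sum_pmf (insert j J) X) K = measure_pmf.expectation (X j) ?g"
    using insert by (simp add: sum_pmf_insert prob_conv_pmf)
  also obtain Y where Y: "finite Y" "card Y = ?m" "measure_pmf.expectation (X j) ?g \<le> (\<Sum>x\<in>Y. ?g x) / real ?m"
    using expectation_le_average_on_top[of "X j" ?m ?g] insert.prems h by auto
  note Y(3)
  also have "(\<Sum>x\<in>Y. ?g x) = (\<Sum>x\<in>Y. \<Sum>s\<in>K. pmf ?S (s + (- x)))"
  proof (rule sum.cong)
    fix x
    have "{b. x + b \<in> K} = (\<lambda>s. s + (- x)) ` K"
      by (auto simp: image_iff) (metis add.commute add_diff_cancel_left')
    then show "?g x = (\<Sum>s\<in>K. pmf ?S (s + (- x)))"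
      using insert.prems(3) by (simp add: measure_measure_pmf_finite sum.reindex inj_on_def)
  qed simp
  \<comment> \<open>The condition \<open>x + b\<close> in \<open>K\<close> places \<open>b\<close>
    in the translate of \<open>K\<close> by \<open>- x\<close>, so \<open>Y\<close> enters the
    sumset reflected.\<close>
  also have "\<dots> = (\<Sum>s\<in>K. \<Sum>x\<in>uminus ` Y. pmf ?S (s + x))"
    by (subst sum.swap) (simp add: sum.reindex)
  also have "\<dots> \<le> (\<Sum>i<min (card K) ?m. ?D (card K + ?m - 1 - 2 * i))"
  proof (rule sum_sumset_le_hooks)
    fix T :: "real set" assume "finite T"
    then show "(\<Sum>s\<in>T. pmf ?S s) \<le> ?D (card T)"
      using insert.IH[of T] insert.prems by (simp add: measure_measure_pmf_finite)
  qed (use Y insert.prems in \<open>auto simp: card_image\<close>)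
  also have "\<dots> / real ?m \<le> measure_pmf.prob (conv_pmf (step_pmf h) ?R) {- real (card K) <.. real (card K)}"
    by (rule step_window_recursion) (use h insert in auto)
  finally show ?case
    using insert by (simp add: sum_pmf_insert divide_right_mono)
qed

text \<open>The \<open>h\<close> values of \<open>B\<close> lie in different classes modulo
  \<open>2 * h\<close>, so one summand alone, whatever the others are, hits the required class with
  probability at most \<open>1 / h\<close>.\<close>

lemma prob_residue_class_le:
  assumes h: "h > 0"
  defines "B \<equiv> map_pmf (\<lambda>b. 2 * real b - (2 * real h - 1)) (pmf_of_set {..<h})"
  assumes J: "finite J" "J \<noteq> {}"
  shows "measure_pmf.prob (sum_pmf J (\<lambda>_. B)) {a. \<exists>j::int. x - a = 2 * real h * j} \<le> 1 / real h"
proof -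
  have finB: "finite (set_pmf B)" using h by (simp add: B_def lessThan_empty_iff)
  obtain j J' where J': "J = insert j J'" "j \<notin> J'" "finite J'"
    using J by (metis Diff_iff finite_Diff insertI1 insert_Diff ex_in_conv)
  have "measure_pmf.prob B {b. a + b \<in> {a. \<exists>j::int. x - a = 2 * real h * j}} \<le> 1 / real h" for a
  proof -
    let ?C = "{b \<in> {..<h}. \<exists>j::int. x - (a + (2 * real b - (2 * real h - 1))) = 2 * real h * j}"
    have "b = b'" if bb: "b \<in> ?C" "b' \<in> ?C" for b b'
    proof -
      from bb obtain i j :: int where
        "x - (a + (2 * real b - (2 * real h - 1))) = 2 * real h * i"
        "x - (a + (2 * real b' - (2 * real h - 1))) = 2 * real h * j" by blast
      then have "2 * real h * i - 2 * real h * j = 2 * real b' - 2 * real b" by linarith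
      then have "real_of_int (int b' - int b) = real_of_int (int h * (i - j))" by (simp add: algebra_simps)
      then have eq: "int b' - int b = int h * (i - j)" by (simp only: of_int_eq_iff)
      moreover have "\<bar>int b' - int b\<bar> < int h" using bb by auto
      ultimately have "int h * \<bar>i - j\<bar> < int h * 1" by (simp add: abs_mult)
      then have "i = j" using h by (simp add: mult_less_cancel_left)
      then show ?thesis using eq by simp
    qed
    then have "card ?C \<le> 1" by (intro card_le_Suc0_iff_eq[THEN iffD2, folded One_nat_def]) auto
    moreover have "{..<h} \<inter> {b. \<exists>j::int. x - (a + (2 * real b - (2 * real h - 1))) = 2 * real h * j} = ?C" by auto
    ultimately show ?thesis
      unfolding B_def using h by (simp add: vimage_def measure_pmf_of_set lessThan_empty_iff divide_right_mono)
  qed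
  then show ?thesis
    unfolding J'(1) sum_pmf_insert[OF J'(3,2)] conv_pmf_commute[of B] prob_conv_pmf
    by (intro expectation_le_const) (auto simp: J' finB)
qed

text \<open>A uniform index below \<open>2 * h\<close> is \<open>b + h * e\<close> with
  \<open>b\<close> uniform below \<open>h\<close> and \<open>e\<close> a fair bit. The bits add up
  to \<open>2 * h\<close> times a binomial variable; the \<open>b\<close> decide whether the rest of
  the target is a multiple of \<open>2 * h\<close>. The two savings multiply.\<close>

lemma pmf_sum_step_le:
  assumes h: "h > 0" and J: "finite J" "J \<noteq> {}"
  shows "pmf (sum_pmf J (\<lambda>_. step_pmf h)) x \<le> 1 / (real h * sqrt (real (card J)))"
proof -
  define B where "B = map_pmf (\<lambda>b. 2 * real b - (2 * real h - 1)) (pmf_of_set {..<h})"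
  define E where "E = map_pmf (\<lambda>e. 2 * real h * (if e then 1 else 0)) (bernoulli_pmf (1/2))"
  let ?SB = "sum_pmf J (\<lambda>_. B)" and ?SE = "sum_pmf J (\<lambda>_. E)"
  have finB: "finite (set_pmf B)" using h by (simp add: B_def lessThan_empty_iff)
  have step: "step_pmf h = conv_pmf B E"
  proof -
    have "bernoulli_pmf (1/2) = pmf_of_set (UNIV :: bool set)"
      by (rule pmf_eqI) (simp add: pmf_of_set UNIV_bool)
    then have 1: "pair_pmf (pmf_of_set {..<h}) (bernoulli_pmf (1/2)) = pmf_of_set ({..<h} \<times> UNIV)"
      using h by (intro pmf_eqI) (auto simp: pmf_pair pmf_of_set lessThan_empty_iff indicator_def)
    have bij: "bij_betw (\<lambda>(b, e). b + h * (if e then 1 else 0)) ({..<h} \<times> UNIV) {..<2 * h}"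
      by (rule bij_betw_byWitness[where f' = "\<lambda>u. (u mod h, h \<le> u)"]) (auto simp: le_mod_geq)
    have "pmf_of_set {..<2 * h} = map_pmf (\<lambda>(b, e). b + h * (if e then 1 else 0)) (pmf_of_set ({..<h} \<times> UNIV))"
      using h by (intro map_pmf_of_set_bij_betw[symmetric] bij) (auto simp: lessThan_empty_iff)
    then show ?thesis
      unfolding step_pmf_def conv_pmf_def B_def E_def pair_map_pmf1 pair_map_pmf2 1
      by (simp add: pmf.map_comp o_def case_prod_unfold apfst_def apsnd_def map_prod_def)
         (auto intro!: map_pmf_cong)
  qed
  have SE: "?SE = map_pmf (\<lambda>k. 2 * real h * real k) (binomial_pmf (card J) (1/2))"
  proof -
    have "?SE = map_pmf (\<lambda>f. \<Sum>i\<in>J. 2 * real h * (if f i then 1 else 0)) (Pi_pmf J False (\<lambda>_. bernoulli_pmf (1/2)))"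
      unfolding E_def using J by (subst map_pmf_Pi_pmf_sum) auto
    moreover have "(\<Sum>i\<in>J. 2 * real h * (if f i then 1 else 0)) = 2 * real h * real (card {i \<in> J. f i})" for f
      using J by (simp add: sum_distrib_left[symmetric] sum.If_cases Int_def)
    ultimately show ?thesis
      using J by (subst binomial_pmf_altdef'[of J]) (auto simp: pmf.map_comp o_def)
  qed
  \<comment> \<open>The binomial part alone gives only \<open>1 / sqrt (card J)\<close>. The
    indicator records its support in the multiples of \<open>2 * h\<close>, from which the factor
    \<open>1 / h\<close> is gained.\<close>
  have pSE: "pmf ?SE y \<le> 1 / sqrt (real (card J)) * indicator {y. \<exists>j::int. y = 2 * real h * j} y" for y
  proof (cases "\<exists>k::nat. y = 2 * real h * real k")
    case True
    then obtain k :: nat where k: "y = 2 * real h * real k" by blast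
    then have "\<exists>j::int. y = 2 * real h * j" by (intro exI[of _ "int k"]) simp
    moreover have "pmf ?SE y = pmf (binomial_pmf (card J) (1/2)) k"
      unfolding SE k using h by (intro pmf_map_inj') (auto simp: inj_on_def)
    moreover have "\<dots> \<le> 1 / sqrt (real (card J))"
    proof (cases "k \<le> card J")
      case True
      then have "pmf (binomial_pmf (card J) (1/2)) k = real (card J choose k) / 2 ^ card J"
        by (simp add: power_add[symmetric] power_divide)
      then show ?thesis using binomial_le_power_div_sqrt[of "card J" k] J by (simp add: card_gt_0_iff)
    qed (simp add: binomial_eq_0)
    ultimately show ?thesis by simp
  next
    case False
    then have "pmf ?SE y = 0" unfolding SE by (intro pmf_map_outside) auto
    then show ?thesis by simp
  qed
  have "pmf (sum_pmf J (\<lambda>_. step_pmf h)) x = measure_pmf.expectation ?SB (\<lambda>a. pmf ?SE (x - a))"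
    unfolding step using J by (simp add: sum_pmf_conv pmf_conv_pmf)
  also have "\<dots> \<le> measure_pmf.expectation ?SB
     (\<lambda>a. 1 / sqrt (real (card J)) * indicator {a. \<exists>j::int. x - a = 2 * real h * j} a)"
    by (intro expectation_mono_pmf) (use J finB pSE[of "x - _"] in \<open>auto simp: indicator_def\<close>)
  also have "\<dots> = 1 / sqrt (real (card J)) * measure_pmf.prob ?SB {a. \<exists>j::int. x - a = 2 * real h * j}"
    by simp
  also have "\<dots> \<le> 1 / sqrt (real (card J)) * (1 / real h)"
    unfolding B_def by (intro mult_left_mono prob_residue_class_le h J) auto
  finally show ?thesis by (simp add: mult.commute)
qed

lemma set_sum_step_pmf_Ints:
  assumes "h > 0" "finite J"
  shows "set_pmf (sum_pmf J (\<lambda>_. step_pmf h)) \<subseteq> \<int>"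
  using assms(2)
proof (induction J)
  case (insert j J)
  have "set_pmf (step_pmf h) \<subseteq> \<int>"
    using assms(1) by (auto simp: step_pmf_def lessThan_empty_iff)
  then show ?case using insert by (auto simp: sum_pmf_insert conv_pmf_def intro!: Ints_add)
qed simp

text \<open>Kesten's inequality: a singleton is compared with the window \<open>{-1<..1}\<close>,
  which contains only two integers, hence the 2.\<close>

lemma pmf_sum_le_atom_div_sqrt:
  assumes h: "h > 0" and J: "finite J" "J \<noteq> {}"
    and X: "\<And>j. j \<in> J \<Longrightarrow> finite (set_pmf (X j))" "\<And>j x. j \<in> J \<Longrightarrow> pmf (X j) x \<le> 1 / real (2 * h)"
  shows "pmf (sum_pmf J X) x \<le> 2 / (real h * sqrt (real (card J)))"
proof -
  let ?R = "sum_pmf J (\<lambda>_. step_pmf h)"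
  have "pmf (sum_pmf J X) x \<le> measure_pmf.prob ?R {-1<..1}"
    using prob_sum_pmf_le_step[OF h J(1) X, where K="{x}"] by (simp add: measure_pmf_single)
  also have "\<dots> \<le> measure_pmf.prob ?R {0, 1}"
  proof -
    have "{-1<..1} \<inter> set_pmf ?R \<subseteq> {0, 1 :: real}"
    proof
      fix y assume "y \<in> {-1<..1} \<inter> set_pmf ?R"
      then obtain i :: int where "y = of_int i" "-1 < y" "y \<le> 1"
        using set_sum_step_pmf_Ints[OF h J(1)] by (auto elim: Ints_cases)
      then show "y \<in> {0, 1}" by auto
    qed
    then have "measure_pmf.prob ?R ({-1<..1} \<inter> set_pmf ?R) \<le> measure_pmf.prob ?R {0, 1}"
      by (intro measure_pmf.finite_measure_mono) auto
    then show ?thesis by (simp add: measure_Int_set_pmf)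
  qed
  also have "\<dots> = pmf ?R 0 + pmf ?R 1"
    by (simp add: measure_measure_pmf_finite)
  also have "\<dots> \<le> 1 / (real h * sqrt (real (card J))) + 1 / (real h * sqrt (real (card J)))"
    by (intro add_mono pmf_sum_step_le h J)
  finally show ?thesis by simp
qed

section \<open>Incidences with a Cartesian product\<close>

text \<open>Inside a cell, the weight of the points on a line exceeds \<open>M\<close> only through pairs of distinct points,
  and each such pair lies on at most one line.\<close>
lemma weighted_incidence_bound:
  fixes \<omega> :: "'a \<Rightarrow> real" and \<rho> :: "'b \<Rightarrow> real" and inc :: "'a \<Rightarrow> 'b \<Rightarrow> bool" and \<kappa> :: "'a \<Rightarrow> 'c"
  assumes fin: "finite P" "finite L" and M: "M > 0"
    and \<omega>: "\<And>p. p \<in> P \<Longrightarrow> 0 \<le> \<omega> p" "\<And>p. p \<in> P \<Longrightarrow> \<omega> p \<le> M" "(\<Sum>p\<in>P. \<omega> p) \<le> 1"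
    and \<rho>: "\<And>l. l \<in> L \<Longrightarrow> 0 \<le> \<rho> l" "\<And>l. l \<in> L \<Longrightarrow> \<rho> l \<le> M" "(\<Sum>l\<in>L. \<rho> l) \<le> 1"
    and uniq: "\<And>p p' l l'. p \<noteq> p' \<Longrightarrow> inc p l \<Longrightarrow> inc p' l \<Longrightarrow> inc p l' \<Longrightarrow> inc p' l' \<Longrightarrow> l = l'"
    and cells: "\<And>l. l \<in> L \<Longrightarrow> card (\<kappa> ` {p \<in> P. inc p l}) \<le> c"
    and mass: "\<And>k. (\<Sum>p\<in>{p \<in> P. \<kappa> p = k}. \<omega> p) \<le> \<mu>"
  shows "(\<Sum>l\<in>L. \<rho> l * (\<Sum>p\<in>{p \<in> P. inc p l}. \<omega> p)) \<le> real c * M + \<mu>"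
proof -
  define N where "N = (\<lambda>p. {p' \<in> P. p' \<noteq> p \<and> \<kappa> p' = \<kappa> p})"
  define T where "T = (\<lambda>l. \<Sum>p\<in>{p \<in> P. inc p l}. \<Sum>p'\<in>{p' \<in> N p. inc p' l}. \<omega> p * \<omega> p')"
  have line: "(\<Sum>p\<in>{p \<in> P. inc p l}. \<omega> p) \<le> real c * M + T l / M" if l: "l \<in> L" for l
  proof -
    let ?A = "{p \<in> P. inc p l}"
    let ?B = "\<lambda>k. {p \<in> ?A. \<kappa> p = k}"
    have finA: "finite ?A" using fin by simp
    have cell: "(\<Sum>p\<in>?B k. \<omega> p) \<le> M + (\<Sum>p\<in>?B k. \<Sum>p'\<in>{p' \<in> N p. inc p' l}. \<omega> p * \<omega> p') / M" for k
    proof -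
      let ?S = "\<Sum>p\<in>?B k. \<omega> p"
      let ?Q = "\<Sum>p\<in>?B k. \<Sum>p'\<in>{p' \<in> N p. inc p' l}. \<omega> p * \<omega> p'"
      have finB: "finite (?B k)" using fin by simp
      have S0: "0 \<le> ?S" using \<omega> by (intro sum_nonneg) auto
      have Q0: "0 \<le> ?Q" using \<omega> by (intro sum_nonneg mult_nonneg_nonneg) (auto simp: N_def)
      have "?S * ?S = (\<Sum>p\<in>?B k. \<omega> p * \<omega> p + (\<Sum>p'\<in>{p' \<in> N p. inc p' l}. \<omega> p * \<omega> p'))"
        unfolding sum_product
      proof (rule sum.cong[OF refl])
        fix p assume p: "p \<in> ?B k"
        have "?B k = insert p {p' \<in> N p. inc p' l}" using p by (auto simp: N_def)
        moreover have "p \<notin> {p' \<in> N p. inc p' l}" "finite {p' \<in> N p. inc p' l}"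
          using fin by (auto simp: N_def)
        ultimately show "(\<Sum>p'\<in>?B k. \<omega> p * \<omega> p') = \<omega> p * \<omega> p + (\<Sum>p'\<in>{p' \<in> N p. inc p' l}. \<omega> p * \<omega> p')"
          by simp
      qed
      also have "\<dots> \<le> M * ?S + ?Q"
        unfolding sum.distrib sum_distrib_left using \<omega> by (intro add_right_mono sum_mono mult_right_mono) auto
      finally have "?S * (?S - M) \<le> ?Q" by (simp add: algebra_simps)
      \<comment> \<open>If \<open>?S > M\<close>, lowering one factor \<open>?S\<close> to
        \<open>M\<close> decreases the product; otherwise \<open>M * (?S - M)\<close> is
        nonpositive. Either way the excess of a cell over \<open>M\<close> is at most
        \<open>?Q / M\<close>.\<close>
      moreover have "M * (?S - M) \<le> ?S * (?S - M)" if "?S > M"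
        by (rule mult_right_mono) (use that in simp_all)
      moreover have "M * (?S - M) \<le> 0" if "\<not> ?S > M"
        by (rule mult_nonneg_nonpos) (use that M in simp_all)
      ultimately have "M * (?S - M) \<le> ?Q"
        using Q0 by (meson order_trans)
      then show ?thesis using M by (simp add: field_simps)
    qed
    have "(\<Sum>p\<in>?A. \<omega> p) = (\<Sum>k\<in>\<kappa> ` ?A. \<Sum>p\<in>?B k. \<omega> p)"
      by (rule sum.group[symmetric]) (use finA in auto)
    also have "\<dots> \<le> (\<Sum>k\<in>\<kappa> ` ?A. M + (\<Sum>p\<in>?B k. \<Sum>p'\<in>{p' \<in> N p. inc p' l}. \<omega> p * \<omega> p') / M)"
      by (intro sum_mono cell)
    also have "\<dots> = real (card (\<kappa> ` ?A)) * M + (\<Sum>k\<in>\<kappa> ` ?A. \<Sum>p\<in>?B k. \<Sum>p'\<in>{p' \<in> N p. inc p' l}. \<omega> p * \<omega> p') / M"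
      by (simp add: sum.distrib sum_divide_distrib)
    also have "(\<Sum>k\<in>\<kappa> ` ?A. \<Sum>p\<in>?B k. \<Sum>p'\<in>{p' \<in> N p. inc p' l}. \<omega> p * \<omega> p') = T l"
      unfolding T_def by (rule sum.group) (use finA in auto)
    also have "real (card (\<kappa> ` ?A)) * M \<le> real c * M"
      using cells[OF l] M by (intro mult_right_mono) auto
    finally show ?thesis by simp
  qed
  \<comment> \<open>Each ordered pair of points sharing a cell lies on at most one line, of weight
    at most \<open>M\<close>; the companions of a point weigh at most \<open>\<mu>\<close>, and all
    points at most 1. The division by \<open>M\<close> in \<open>line\<close> turns this into the
    summand \<open>\<mu>\<close>.\<close>
  have "(\<Sum>l\<in>L. \<rho> l * T l) \<le> M * \<mu>"
  proof -
    have "(\<Sum>l\<in>L. \<rho> l * T l) =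
        (\<Sum>l\<in>L. \<Sum>p\<in>P. \<Sum>p'\<in>N p. if inc p l \<and> inc p' l then \<rho> l * (\<omega> p * \<omega> p') else 0)"
    proof (rule sum.cong[OF refl])
      fix l
      have finN: "finite (N p)" for p using fin by (simp add: N_def)
      have "T l = (\<Sum>p\<in>P. if inc p l then \<Sum>p'\<in>N p. if inc p' l then \<omega> p * \<omega> p' else 0 else 0)"
        unfolding T_def using fin finN by (simp add: sum.inter_filter)
      also have "\<rho> l * \<dots> = (\<Sum>p\<in>P. \<Sum>p'\<in>N p. if inc p l \<and> inc p' l then \<rho> l * (\<omega> p * \<omega> p') else 0)"
        unfolding sum_distrib_left by (intro sum.cong refl) (auto simp: sum_distrib_left intro!: sum.cong)
      finally show "\<rho> l * T l = (\<Sum>p\<in>P. \<Sum>p'\<in>N p. if inc p l \<and> inc p' l then \<rho> l * (\<omega> p * \<omega> p') else 0)" .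
    qed
    also have "\<dots> = (\<Sum>p\<in>P. \<Sum>p'\<in>N p. \<Sum>l\<in>L. if inc p l \<and> inc p' l then \<rho> l * (\<omega> p * \<omega> p') else 0)"
      by (subst sum.swap) (intro sum.cong refl sum.swap)
    also have "\<dots> \<le> (\<Sum>p\<in>P. \<Sum>p'\<in>N p. M * (\<omega> p * \<omega> p'))"
    proof (intro sum_mono)
      fix p p' assume p: "p \<in> P" "p' \<in> N p"
      let ?E = "{l \<in> L. inc p l \<and> inc p' l}"
      have ne: "p \<noteq> p'" "p' \<in> P" using p by (auto simp: N_def)
      have nn: "0 \<le> \<omega> p * \<omega> p'" using p ne \<omega> by simp
      have eq: "(\<Sum>l\<in>L. if inc p l \<and> inc p' l then \<rho> l * (\<omega> p * \<omega> p') else 0) = (\<Sum>l\<in>?E. \<rho> l * (\<omega> p * \<omega> p'))"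
        using fin by (simp add: sum.inter_filter)
      show "(\<Sum>l\<in>L. if inc p l \<and> inc p' l then \<rho> l * (\<omega> p * \<omega> p') else 0) \<le> M * (\<omega> p * \<omega> p')"
      proof (cases "?E = {}")
        case True
        show ?thesis unfolding eq True using M nn by simp
      next
        case False
        then obtain l where l: "l \<in> ?E" by blast
        then have "?E = {l}" using uniq[OF ne(1)] by blast
        moreover have "\<rho> l * (\<omega> p * \<omega> p') \<le> M * (\<omega> p * \<omega> p')"
            using l \<rho> nn by (intro mult_right_mono) auto
          ultimately show ?thesis unfolding eq by simp
      qed
    qed
    also have "\<dots> = M * (\<Sum>p\<in>P. \<omega> p * (\<Sum>p'\<in>N p. \<omega> p'))"
      by (simp add: sum_distrib_left)
    also have "\<dots> \<le> M * (\<Sum>p\<in>P. \<omega> p * \<mu>)"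
    proof (intro mult_left_mono sum_mono)
      fix p assume "p \<in> P"
      have "(\<Sum>p'\<in>N p. \<omega> p') \<le> (\<Sum>p'\<in>{p' \<in> P. \<kappa> p' = \<kappa> p}. \<omega> p')"
        using fin \<omega> by (intro sum_mono2) (auto simp: N_def)
      then show "(\<Sum>p'\<in>N p. \<omega> p') \<le> \<mu>" using mass[of "\<kappa> p"] by simp
    qed (use M \<omega> in auto)
    also have "\<dots> \<le> M * (1 * \<mu>)"
      unfolding sum_distrib_right[symmetric]
    proof (intro mult_left_mono mult_right_mono \<omega>)
      have "0 \<le> (\<Sum>p\<in>{p \<in> P. \<kappa> p = k}. \<omega> p)" for k using \<omega> by (intro sum_nonneg) auto
      then show "0 \<le> \<mu>" using mass by (meson order_trans)
    qed (use M in auto)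
    finally show ?thesis by simp
  qed
  note T = this
  have "(\<Sum>l\<in>L. \<rho> l * (\<Sum>p\<in>{p \<in> P. inc p l}. \<omega> p)) \<le> (\<Sum>l\<in>L. \<rho> l * (real c * M + T l / M))"
    by (intro sum_mono mult_left_mono line \<rho>)
  also have "\<dots> = (\<Sum>l\<in>L. \<rho> l) * (real c * M) + (\<Sum>l\<in>L. \<rho> l * T l) / M"
    by (simp add: distrib_left sum.distrib sum_distrib_right sum_divide_distrib)
  also have "\<dots> \<le> 1 * (real c * M) + (M * \<mu>) / M"
    using M by (intro add_mono mult_right_mono divide_right_mono \<rho> T) auto
  finally show ?thesis using M by simp
qed

text \<open>Cutting at quantiles gives cells of small mass for any distribution without large atoms,
  and numbers them monotonically, as the chain argument for lines requires.\<close>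

definition quantile_cell :: "nat \<Rightarrow> real pmf \<Rightarrow> real \<Rightarrow> int" where
  "quantile_cell s R y = \<lfloor>real s * measure_pmf.prob R {..y}\<rfloor>"

lemma quantile_cell_mono: "y \<le> y' \<Longrightarrow> quantile_cell s R y \<le> quantile_cell s R y'"
  unfolding quantile_cell_def
  by (intro floor_mono mult_left_mono measure_pmf.finite_measure_mono) auto

lemma quantile_cell_range: "quantile_cell s R y \<in> {0..int s}"
proof -
  have "real s * measure_pmf.prob R {..y} \<le> real s * 1" by (intro mult_left_mono) auto
  then have "quantile_cell s R y \<le> \<lfloor>real s\<rfloor>" unfolding quantile_cell_def by (intro floor_mono) simp
  then show ?thesis by (simp add: quantile_cell_def)
qed

text \<open>Between the least and the greatest point of a cell the distribution function grows by
  less than \<open>1 / s\<close>. This increment misses the atom at the least point, which adds at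
  most \<open>a <= 1 / s\<close>.\<close>

lemma quantile_cell_mass:
  assumes fin: "finite (set_pmf R)" and s: "s > 0" and atom: "\<And>y. pmf R y \<le> a" and sa: "real s * a \<le> 1"
  shows "(\<Sum>y\<in>{y \<in> set_pmf R. quantile_cell s R y = j}. pmf R y) \<le> 2 / real s"
proof -
  let ?Y = "{y \<in> set_pmf R. quantile_cell s R y = j}"
  have finY: "finite ?Y" using fin by simp
  show ?thesis
  proof (cases "?Y = {}")
    case False
    define y0 y1 where "y0 = Min ?Y" and "y1 = Max ?Y"
    have y: "y0 \<in> ?Y" "y1 \<in> ?Y" unfolding y0_def y1_def using finY False Min_in Max_in by blast+
    have le: "y0 \<le> y1" unfolding y0_def using y finY by (intro Min_le) auto
    have "real s * measure_pmf.prob R {..y1} - real s * measure_pmf.prob R {..y0} < 1"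
      using y unfolding quantile_cell_def mem_Collect_eq by linarith
    then have F: "measure_pmf.prob R {..y1} - measure_pmf.prob R {..y0} \<le> 1 / real s"
      using s by (simp add: field_simps)
    have a: "a \<le> 1 / real s" using sa s by (simp add: field_simps)
    have "(\<Sum>y\<in>?Y. pmf R y) = measure_pmf.prob R ?Y"
      using finY by (simp add: measure_measure_pmf_finite)
    also have "\<dots> \<le> measure_pmf.prob R ({y0} \<union> ({..y1} - {..y0}))"
    proof (intro measure_pmf.finite_measure_mono)
      have "y0 \<le> y \<and> y \<le> y1" if "y \<in> ?Y" for y
        unfolding y0_def y1_def using finY that by (intro conjI Min_le Max_ge)
      then show "?Y \<subseteq> {y0} \<union> ({..y1} - {..y0})" by fastforce
    qed auto
    also have "\<dots> \<le> measure_pmf.prob R {y0} + measure_pmf.prob R ({..y1} - {..y0})"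
      by (intro measure_Un_le) auto
    also have "measure_pmf.prob R ({..y1} - {..y0}) = measure_pmf.prob R {..y1} - measure_pmf.prob R {..y0}"
      using le by (intro measure_pmf.finite_measure_Diff) auto
    also have "measure_pmf.prob R {y0} + \<dots> \<le> 1 / real s + 1 / real s"
      using F a atom[of y0] by (intro add_mono) (auto simp: measure_pmf_single)
    finally show ?thesis by simp
  next
    case True
    show ?thesis unfolding True by simp
  qed
qed

definition prod_pmf :: "real pmf \<Rightarrow> real pmf \<Rightarrow> real pmf" where
  "prod_pmf A B = map_pmf (\<lambda>(a, b). a * b) (pair_pmf A B)"

text \<open>The cells met by a line form a chain (or, for \<open>v > 0\<close>, an antichain) in the grid of cells,
  so \<open>i + j\<close> (or \<open>i - j\<close>) is injective on them.\<close>
lemma card_cells_on_line: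
  fixes f g :: "real \<Rightarrow> int"
  assumes mono: "\<And>a b. a \<le> b \<Longrightarrow> f a \<le> f b" "\<And>a b. a \<le> b \<Longrightarrow> g a \<le> g b"
    and range: "\<And>a. f a \<in> {0..int s}" "\<And>a. g a \<in> {0..int s}"
    and S: "\<And>p. p \<in> S \<Longrightarrow> fst p * v + snd p = e"
  shows "card ((\<lambda>p. (f (fst p), g (snd p))) ` S) \<le> 2 * s + 1"
proof (cases "v \<le> 0")
  case True
  have "inj_on (\<lambda>(i, j). i + j) ((\<lambda>p. (f (fst p), g (snd p))) ` S)"
  proof (rule inj_onI, clarsimp)
    fix w y w' y' assume p: "(w, y) \<in> S" "(w', y') \<in> S" and eq: "f w + g y = f w' + g y'"
    have e: "y = e - w * v" "y' = e - w' * v" using S[OF p(1)] S[OF p(2)] by auto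
    show "f w = f w' \<and> g y = g y'"
    proof (cases "w \<le> w'")
      case le: True
      then have "y \<le> y'" unfolding e using True by (simp add: mult_right_mono_neg)
      then show ?thesis using mono(1)[OF le] mono(2)[of y y'] eq by auto
    next
      case False
      then have "y' \<le> y" unfolding e using True by (simp add: mult_right_mono_neg)
      then show ?thesis using mono(1)[of w' w] mono(2)[of y' y] eq False by auto
    qed
  qed
  moreover have "(\<lambda>(i, j). i + j) ` ((\<lambda>p. (f (fst p), g (snd p))) ` S) \<subseteq> {0..2 * int s}"
  proof safe
    fix w y
    show "f (fst (w, y)) + g (snd (w, y)) \<in> {0..2 * int s}"
      using range(1)[of w] range(2)[of y] by auto
  qed
  ultimately show ?thesis using card_inj_on_le[of _ _ "{0..2 * int s}"] by fastforce
next
  case False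
  have "inj_on (\<lambda>(i, j). i - j) ((\<lambda>p. (f (fst p), g (snd p))) ` S)"
  proof (rule inj_onI, clarsimp)
    fix w y w' y' assume p: "(w, y) \<in> S" "(w', y') \<in> S" and eq: "f w - g y = f w' - g y'"
    have e: "y = e - w * v" "y' = e - w' * v" using S[OF p(1)] S[OF p(2)] by auto
    show "f w = f w' \<and> g y = g y'"
    proof (cases "w \<le> w'")
      case le: True
      then have "y' \<le> y" unfolding e using False by (simp add: mult_right_mono)
      then show ?thesis using mono(1)[OF le] mono(2)[of y' y] eq by auto
    next
      case False': False
      then have "y \<le> y'" unfolding e using False by (simp add: mult_right_mono)
      then show ?thesis using mono(1)[of w' w] mono(2)[of y y'] eq False' by auto
    qed
  qed
  moreover have "(\<lambda>(i, j). i - j) ` ((\<lambda>p. (f (fst p), g (snd p))) ` S) \<subseteq> {- int s..int s}"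
  proof safe
    fix w y
    show "f (fst (w, y)) - g (snd (w, y)) \<in> {- int s..int s}"
      using range(1)[of w] range(2)[of y] by auto
  qed
  ultimately show ?thesis using card_inj_on_le[of _ _ "{- int s..int s}"] by fastforce
qed

text \<open>The incidence bound with products of quantile cells: \<open>M\<close> is
  \<open>a * \<alpha>\<close>, a line meets at most \<open>2 * s + 1\<close> cells, and a cell has
  mass at most \<open>(2 / s)^2\<close>. The conditions on \<open>s\<close> keep every atom at most
  \<open>1 / s\<close>. The choice of \<open>s\<close> stays open so that the two summands can be
  balanced later.\<close>

lemma pmf_prod_conv_le:
  assumes fin: "finite (set_pmf A)" "finite (set_pmf C)" "finite (set_pmf P)" "finite (set_pmf Q)"
    and A: "\<And>x. pmf A x \<le> a" and C: "\<And>x. pmf C x \<le> a"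
    and P: "\<And>x. pmf P x \<le> \<alpha>" and Q: "\<And>x. pmf Q x \<le> \<alpha>"
    and s: "s > 0" "real s * a \<le> 1" "real s * \<alpha> \<le> 1"
  shows "pmf (conv_pmf (prod_pmf A C) (conv_pmf P Q)) x \<le> (2 * real s + 1) * (a * \<alpha>) + 4 / (real s)\<^sup>2"
proof -
  define Pt L where "Pt = pair_pmf A P" and "L = pair_pmf C Q"
  define inc where "inc = (\<lambda>p l. fst p * fst l + snd p + snd l = x)"
  define \<kappa> where "\<kappa> = (\<lambda>p. (quantile_cell s A (fst p), quantile_cell s P (snd p)))"
  have finPL: "finite (set_pmf Pt)" "finite (set_pmf L)" using fin by (auto simp: Pt_def L_def)
  have a0: "a > 0" using A set_pmf_not_empty[of A] by (meson less_le_trans pmf_positive ex_in_conv)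
  have \<alpha>0: "\<alpha> > 0" using P set_pmf_not_empty[of P] by (meson less_le_trans pmf_positive ex_in_conv)
  have "conv_pmf (prod_pmf A C) (conv_pmf P Q) = map_pmf (\<lambda>(l, p). fst p * fst l + snd p + snd l) (pair_pmf L Pt)"
  proof -
    have "map_pmf (\<lambda>(l, p). fst p * fst l + snd p + snd l) (pair_pmf L Pt) =
        bind_pmf C (\<lambda>v. bind_pmf Q (\<lambda>z. bind_pmf A (\<lambda>w. bind_pmf P (\<lambda>y. return_pmf (w * v + y + z)))))"
      by (simp add: Pt_def L_def pair_pmf_def map_pmf_def bind_assoc_pmf bind_return_pmf)
    also have "\<dots> = bind_pmf C (\<lambda>v. bind_pmf A (\<lambda>w. bind_pmf Q (\<lambda>z. bind_pmf P (\<lambda>y. return_pmf (w * v + y + z)))))"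
      by (intro bind_pmf_cong refl bind_commute_pmf)
    also have "\<dots> = bind_pmf A (\<lambda>w. bind_pmf C (\<lambda>v. bind_pmf Q (\<lambda>z. bind_pmf P (\<lambda>y. return_pmf (w * v + y + z)))))"
      by (rule bind_commute_pmf)
    also have "\<dots> = bind_pmf A (\<lambda>w. bind_pmf C (\<lambda>v. bind_pmf P (\<lambda>y. bind_pmf Q (\<lambda>z. return_pmf (w * v + y + z)))))"
      by (intro bind_pmf_cong refl bind_commute_pmf)
    also have "\<dots> = conv_pmf (prod_pmf A C) (conv_pmf P Q)"
      by (simp add: conv_pmf_def prod_pmf_def pair_pmf_def map_pmf_def bind_assoc_pmf bind_return_pmf add.assoc)
    finally show ?thesis ..
  qed
  then have "pmf (conv_pmf (prod_pmf A C) (conv_pmf P Q)) x = measure_pmf.prob (pair_pmf L Pt) {(l, p). inc p l}"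
    by (simp add: pmf_map inc_def vimage_def case_prod_unfold)
  also have "\<dots> = (\<Sum>l\<in>set_pmf L. pmf L l * measure_pmf.prob Pt {p. inc p l})"
    by (simp add: prob_pair_pmf expectation_finite_pmf finPL)
  also have "\<dots> = (\<Sum>l\<in>set_pmf L. pmf L l * (\<Sum>p\<in>{p \<in> set_pmf Pt. inc p l}. pmf Pt p))"
  proof (intro sum.cong refl)
    fix l
    have "measure_pmf.prob Pt {p. inc p l} = measure_pmf.prob Pt ({p. inc p l} \<inter> set_pmf Pt)"
      by (simp add: measure_Int_set_pmf)
    also have "\<dots> = (\<Sum>p\<in>{p \<in> set_pmf Pt. inc p l}. pmf Pt p)"
      using finPL by (subst measure_measure_pmf_finite) (auto simp: Int_def conj_commute)
    finally show "pmf L l * measure_pmf.prob Pt {p. inc p l} = pmf L l * (\<Sum>p\<in>{p \<in> set_pmf Pt. inc p l}. pmf Pt p)" by simp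
  qed
  also have "\<dots> \<le> real (2 * s + 1) * (a * \<alpha>) + (2 / real s) * (2 / real s)"
  proof (rule weighted_incidence_bound[where \<kappa> = \<kappa>])
    show "a * \<alpha> > 0" using a0 \<alpha>0 by simp
    show "pmf Pt p \<le> a * \<alpha>" for p
      by (cases p) (use A P a0 \<alpha>0 in \<open>auto simp: Pt_def pmf_pair intro!: mult_mono\<close>)
    show "pmf L p \<le> a * \<alpha>" for p
      by (cases p) (use C Q a0 \<alpha>0 in \<open>auto simp: L_def pmf_pair intro!: mult_mono\<close>)
    show "l = l'" if "p \<noteq> p'" "inc p l" "inc p' l" "inc p l'" "inc p' l'" for p p' l l'
    proof -
      obtain w y w' y' v z v' z' where e: "p = (w, y)" "p' = (w', y')" "l = (v, z)" "l' = (v', z')"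
        by (metis surj_pair)
      have eqs: "w * v + y + z = x" "w' * v + y' + z = x" "w * v' + y + z' = x" "w' * v' + y' + z' = x"
        using that(2-) by (auto simp: inc_def e)
      have "w \<noteq> w'" using eqs(1,2) that(1) e by auto
      moreover have "(w - w') * (v - v') = 0" using eqs by (simp add: left_diff_distrib right_diff_distrib)
      ultimately have "v = v'" by simp
      then show ?thesis using eqs e by auto
    qed
    show "card (\<kappa> ` {p \<in> set_pmf Pt. inc p l}) \<le> 2 * s + 1" for l
      unfolding \<kappa>_def
      by (rule card_cells_on_line[where v = "fst l" and e = "x - snd l"])
         (auto simp: inc_def quantile_cell_mono intro: quantile_cell_range[unfolded atLeastAtMost_iff, THEN conjunct1]
            quantile_cell_range[unfolded atLeastAtMost_iff, THEN conjunct2])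
    show "(\<Sum>p\<in>{p \<in> set_pmf Pt. \<kappa> p = k}. pmf Pt p) \<le> 2 / real s * (2 / real s)" for k
    proof -
      let ?I = "{w \<in> set_pmf A. quantile_cell s A w = fst k}" and ?J = "{y \<in> set_pmf P. quantile_cell s P y = snd k}"
      have "{p \<in> set_pmf Pt. \<kappa> p = k} = ?I \<times> ?J"
        by (auto simp: Pt_def \<kappa>_def)
      then have "(\<Sum>p\<in>{p \<in> set_pmf Pt. \<kappa> p = k}. pmf Pt p) = (\<Sum>w\<in>?I. pmf A w) * (\<Sum>y\<in>?J. pmf P y)"
        by (auto simp: sum_product sum.cartesian_product Pt_def pmf_pair intro!: sum.cong)
      also have "\<dots> \<le> 2 / real s * (2 / real s)"
        by (intro mult_mono quantile_cell_mass[OF fin(1) s(1) A s(2)] quantile_cell_mass[OF fin(3) s(1) P s(3)])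
           (auto intro: sum_nonneg)
      finally show ?thesis .
    qed
  qed (use finPL in \<open>auto simp: sum_pmf_eq_1\<close>)
  also have "real (2 * s + 1) = 2 * real s + 1" by simp
  also have "2 / real s * (2 / real s) = 4 / (real s)\<^sup>2" by (simp add: power2_eq_square)
  finally show ?thesis .
qed

section \<open>Sums of products of random differences\<close>

definition conv_pow :: "real pmf \<Rightarrow> nat \<Rightarrow> real pmf" where
  "conv_pow T d = (conv_pmf T ^^ d) (return_pmf 0)"

lemma conv_pow_0 [simp]: "conv_pow T 0 = return_pmf 0"
  and conv_pow_Suc: "conv_pow T (Suc d) = conv_pmf T (conv_pow T d)"
  by (simp_all add: conv_pow_def)

lemma conv_pow_add: "conv_pow T (d + e) = conv_pmf (conv_pow T d) (conv_pow T e)"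
  by (induction d) (simp_all add: conv_pow_Suc conv_pmf_assoc)

lemma finite_conv_pow [simp]: "finite (set_pmf T) \<Longrightarrow> finite (set_pmf (conv_pow T d))"
  by (induction d) (simp_all add: conv_pow_Suc)

lemma sum_pmf_const: "finite I \<Longrightarrow> sum_pmf I (\<lambda>_. T) = conv_pow T (card I)"
  by (induction I rule: finite_induct) (simp_all add: sum_pmf_insert conv_pow_Suc)

lemma pmf_conv_pow_antimono:
  assumes "finite (set_pmf T)" "d \<le> e" "\<And>x. pmf (conv_pow T d) x \<le> c"
  shows "pmf (conv_pow T e) x \<le> c"
proof -
  have "conv_pow T e = conv_pmf (conv_pow T (e - d)) (conv_pow T d)"
    using assms(2) by (simp add: conv_pow_add[symmetric])
  then show ?thesis using assms by (simp add: pmf_conv_pmf_le)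
qed

lemma conv_bind_pmf: "conv_pmf (bind_pmf A f) B = bind_pmf A (\<lambda>a. conv_pmf (f a) B)"
  by (simp add: conv_pmf_def pair_pmf_def map_pmf_def bind_assoc_pmf)

lemma pmf_bind_le:
  assumes "finite (set_pmf A)" "\<And>a. a \<in> set_pmf A \<Longrightarrow> pmf (f a) x \<le> c"
  shows "pmf (bind_pmf A f) x \<le> c"
  unfolding pmf_bind by (rule expectation_le_const[OF assms])

text \<open>Law of one coefficient \<open>c_k\<close> in the model with independent indices.
  Repetitions are allowed, so the value 0 can occur; for injective \<open>w\<close> and
  \<open>v\<close> its mass is still only of order \<open>1 / n\<close>.\<close>

definition diff_prod_pmf :: "nat \<Rightarrow> (nat \<Rightarrow> real) \<Rightarrow> (nat \<Rightarrow> real) \<Rightarrow> real pmf" where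
  "diff_prod_pmf n w v = map_pmf (\<lambda>((a, b), (c, d)). (w a - w b) * (v c - v d))
     (pair_pmf (pair_pmf (pmf_of_set {1..n}) (pmf_of_set {1..n})) (pair_pmf (pmf_of_set {1..n}) (pmf_of_set {1..n})))"

lemma bind_pmf_commute4:
  "bind_pmf U (\<lambda>a. bind_pmf U (\<lambda>b. bind_pmf U (\<lambda>c. bind_pmf U (F a b c)))) =
   bind_pmf U (\<lambda>b. bind_pmf U (\<lambda>d. bind_pmf U (\<lambda>a. bind_pmf U (\<lambda>c. F a b c d))))"
proof -
  have "bind_pmf U (\<lambda>c. bind_pmf U (F a b c)) = bind_pmf U (\<lambda>d. bind_pmf U (\<lambda>c. F a b c d))" for a b
    by (rule bind_commute_pmf)
  then have "bind_pmf U (\<lambda>a. bind_pmf U (\<lambda>b. bind_pmf U (\<lambda>c. bind_pmf U (F a b c)))) =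
      bind_pmf U (\<lambda>a. bind_pmf U (\<lambda>b. bind_pmf U (\<lambda>d. bind_pmf U (\<lambda>c. F a b c d))))"
    by simp
  also have "\<dots> = bind_pmf U (\<lambda>b. bind_pmf U (\<lambda>a. bind_pmf U (\<lambda>d. bind_pmf U (\<lambda>c. F a b c d))))"
    by (rule bind_commute_pmf)
  also have "\<dots> = bind_pmf U (\<lambda>b. bind_pmf U (\<lambda>d. bind_pmf U (\<lambda>a. bind_pmf U (\<lambda>c. F a b c d))))"
  proof -
    have "bind_pmf U (\<lambda>a. bind_pmf U (\<lambda>d. bind_pmf U (\<lambda>c. F a b c d))) =
      bind_pmf U (\<lambda>d. bind_pmf U (\<lambda>a. bind_pmf U (\<lambda>c. F a b c d)))" for b
      by (rule bind_commute_pmf)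
    then show ?thesis by simp
  qed
  finally show ?thesis .
qed

text \<open>Fixing \<open>b\<close> and \<open>d\<close> leaves a product of two independent
  factors, each uniform on \<open>n\<close> distinct reals when \<open>w\<close> and
  \<open>v\<close> are injective, so bounds for \<open>prod_pmf\<close> apply inside the
  mixture.\<close>

lemma diff_prod_pmf_mixture:
  fixes n :: nat
  defines "U \<equiv> pmf_of_set {1..n}"
  shows "diff_prod_pmf n w v = bind_pmf (pair_pmf U U)
    (\<lambda>(b, d). prod_pmf (map_pmf (\<lambda>a. w a - w b) U) (map_pmf (\<lambda>c. v c - v d) U))"
proof -
  have "diff_prod_pmf n w v = bind_pmf U (\<lambda>a. bind_pmf U (\<lambda>b. bind_pmf U (\<lambda>c. bind_pmf U
      (\<lambda>d. return_pmf ((w a - w b) * (v c - v d))))))"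
    unfolding diff_prod_pmf_def U_def[symmetric]
    by (simp add: pair_pmf_def map_pmf_def bind_assoc_pmf bind_return_pmf)
  also have "\<dots> = bind_pmf U (\<lambda>b. bind_pmf U (\<lambda>d. bind_pmf U (\<lambda>a. bind_pmf U
      (\<lambda>c. return_pmf ((w a - w b) * (v c - v d))))))"
    by (rule bind_pmf_commute4[where F = "\<lambda>a b c d. return_pmf ((w a - w b) * (v c - v d))"])
  also have "\<dots> = bind_pmf (pair_pmf U U)
    (\<lambda>(b, d). prod_pmf (map_pmf (\<lambda>a. w a - w b) U) (map_pmf (\<lambda>c. v c - v d) U))"
    by (simp add: prod_pmf_def pair_pmf_def map_pmf_def bind_assoc_pmf bind_return_pmf)
  finally show ?thesis .
qed

lemma finite_diff_prod_pmf [simp]: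
  assumes "n > 0"
  shows "finite (set_pmf (diff_prod_pmf n w v))"
proof -
  have "finite (set_pmf (pmf_of_set {1..n}))" using assms by simp
  then show ?thesis
    unfolding diff_prod_pmf_def set_map_pmf set_pair_pmf by (intro finite_imageI finite_cartesian_product)
qed

lemma pmf_shifted_uniform_le:
  fixes w :: "nat \<Rightarrow> real"
  assumes "n > 0" "inj_on w {1..n}"
  shows "pmf (map_pmf (\<lambda>a. w a - c) (pmf_of_set {1..n})) x \<le> 1 / real n"
proof -
  have "card ({1..n} \<inter> {a. w a - c = x}) \<le> 1"
  proof -
    have "a = b" if "a \<in> {1..n} \<inter> {a. w a - c = x}" "b \<in> {1..n} \<inter> {a. w a - c = x}" for a b
    proof (rule inj_onD[OF assms(2)])
      have "w a - c = x" "w b - c = x" using that by auto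
      then show "w a = w b" by linarith
    qed (use that in auto)
    then show ?thesis
      by (intro card_le_Suc0_iff_eq[THEN iffD2, folded One_nat_def]) auto
  qed
  then show ?thesis using assms(1)
    by (simp add: pmf_map measure_pmf_of_set vimage_def divide_right_mono)
qed

text \<open>A nonzero second factor determines the first; the event that the second factor vanishes
  accounts for the other \<open>a\<close>.\<close>

lemma pmf_prod_le:
  assumes fin: "finite (set_pmf A)" "finite (set_pmf C)"
    and A: "\<And>x. pmf A x \<le> a" and C: "\<And>x. pmf C x \<le> a"
  shows "pmf (prod_pmf A C) x \<le> 2 * a"
proof -
  have a0: "0 \<le> a" using A[of 0] pmf_nonneg[of A 0] by linarith
  have "pmf (prod_pmf A C) x = measure_pmf.prob (pair_pmf C A) {(c, a). a * c = x}"
    unfolding prod_pmf_def by (subst pair_commute_pmf) (simp add: pmf_map pmf.map_comp o_def case_prod_unfold vimage_def)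
  also have "\<dots> \<le> measure_pmf.expectation C (\<lambda>c. a + indicator {0} c)"
    unfolding prob_pair_pmf
  proof (rule expectation_mono_pmf[OF fin(2)])
    fix c
    show "measure_pmf.prob A {b. (c, b) \<in> {(c, a). a * c = x}} \<le> a + indicator {0} c"
    proof (cases "c = 0")
      case True
      then show ?thesis using a0 by (simp add: add_increasing measure_pmf.prob_le_1)
    next
      case False
      then have "{b. (c, b) \<in> {(c, a). a * c = x}} = {x / c}" by (auto simp: field_simps)
      then show ?thesis using A False by (simp add: measure_pmf_single)
    qed
  qed
  also have "\<dots> = a + pmf C 0"
  proof -
    have "measure_pmf.expectation C (\<lambda>c. a + indicator {0} c) = a + measure_pmf.prob C {0}"
      by (subst Bochner_Integration.integral_add) (auto simp: integrable_measure_pmf_finite[OF fin(2)])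
    then show ?thesis by (simp add: measure_pmf_single)
  qed
  finally show ?thesis using C[of 0] by linarith
qed

lemma pmf_diff_prod_le:
  assumes "n > 0" "inj_on w {1..n}" "inj_on v {1..n}"
  shows "pmf (diff_prod_pmf n w v) x \<le> 2 / real n"
  unfolding diff_prod_pmf_mixture
proof (rule pmf_bind_le)
  fix bd
  have "pmf (prod_pmf (map_pmf (\<lambda>a. w a - w (fst bd)) (pmf_of_set {1..n}))
      (map_pmf (\<lambda>c. v c - v (snd bd)) (pmf_of_set {1..n}))) x \<le> 2 * (1 / real n)"
    using assms by (intro pmf_prod_le pmf_shifted_uniform_le) auto
  then show "pmf (case bd of (b, d) \<Rightarrow> prod_pmf (map_pmf (\<lambda>a. w a - w b) (pmf_of_set {1..n}))
      (map_pmf (\<lambda>c. v c - v d) (pmf_of_set {1..n}))) x \<le> 2 / real n"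
    by (simp add: case_prod_unfold)
qed (use assms in auto)

text \<open>With \<open>s\<close> about \<open>n / t\<close> both summands of the incidence bound
  are of order \<open>t^2 / n^2\<close>. The condition \<open>t^2 <= n\<close> keeps the atoms
  \<open>t^3 / n^2\<close> below \<open>1 / s\<close>.\<close>

lemma pmf_diff_prod_conv_le:
  assumes n: "n > 0" and w: "inj_on w {1..n}" and v: "inj_on v {1..n}"
    and fin: "finite (set_pmf P)" "finite (set_pmf Q)"
    and t: "t \<ge> 1" "t\<^sup>2 \<le> real n"
    and P: "\<And>x. pmf P x \<le> t ^ 3 / (real n)\<^sup>2" and Q: "\<And>x. pmf Q x \<le> t ^ 3 / (real n)\<^sup>2"
  shows "pmf (conv_pmf (diff_prod_pmf n w v) (conv_pmf P Q)) x \<le> 19 * t\<^sup>2 / (real n)\<^sup>2"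
proof -
  let ?N = "real n" and ?\<alpha> = "t ^ 3 / (real n)\<^sup>2"
  define s where "s = nat \<lfloor>?N / t\<rfloor>"
  have tn: "t \<le> ?N" using t by (smt (verit) power2_eq_square mult_left_mono mult_cancel_left1)
  have q1: "1 \<le> ?N / t" using tn t by simp
  have s1: "real s \<le> ?N / t" and s2: "?N / t < real s + 1" and s0: "s \<ge> 1"
    using q1 unfolding s_def by linarith+
  have s3: "?N / (2 * t) \<le> real s" using s2 s0 by (simp add: field_simps)
  have c1: "real s * (1 / ?N) \<le> 1"
  proof -
    have "?N * 1 \<le> ?N * t" using t by (intro mult_left_mono) auto
    then have "?N / t \<le> ?N" using t by (simp add: field_simps)
    then show ?thesis using s1 n by (simp add: field_simps)
  qed
  have c2: "real s * ?\<alpha> \<le> t\<^sup>2 / ?N"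
  proof -
    have "real s * ?\<alpha> \<le> ?N / t * ?\<alpha>" using s1 t by (intro mult_right_mono) auto
    also have "\<dots> = t\<^sup>2 / ?N" using t n by (simp add: field_simps power2_eq_square power3_eq_cube)
    finally show ?thesis .
  qed
  have "t\<^sup>2 / ?N \<le> 1" using t n by simp
  with c2 have c3: "real s * ?\<alpha> \<le> 1" by linarith
  have "pmf (conv_pmf (diff_prod_pmf n w v) (conv_pmf P Q)) x \<le>
      (2 * real s + 1) * (1 / ?N * ?\<alpha>) + 4 / (real s)\<^sup>2"
    unfolding diff_prod_pmf_mixture conv_bind_pmf
  proof (rule pmf_bind_le)
    fix bd
    show "pmf (conv_pmf (case bd of (b, d) \<Rightarrow> prod_pmf (map_pmf (\<lambda>a. w a - w b) (pmf_of_set {1..n}))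
         (map_pmf (\<lambda>c. v c - v d) (pmf_of_set {1..n}))) (conv_pmf P Q)) x
      \<le> (2 * real s + 1) * (1 / ?N * ?\<alpha>) + 4 / (real s)\<^sup>2"
      unfolding case_prod_unfold
      by (rule pmf_prod_conv_le) (use n fin s0 c1 c3 P Q pmf_shifted_uniform_le[OF n] w v in auto)
  qed (use n in auto)
  \<comment> \<open>Here \<open>2 * s + 1 <= 3 * s\<close> contributes 3 to the constant, and the
    rounding \<open>s >= n / (2 * t)\<close> makes the other summand at most
    \<open>16 * t^2 / n^2\<close>: together 19.\<close>
  also have "(2 * real s + 1) * (1 / ?N * ?\<alpha>) \<le> 3 * real s * (1 / ?N * ?\<alpha>)"
    using s0 t by (intro mult_right_mono) auto
  also have "\<dots> = 3 * (real s * ?\<alpha>) / ?N" by (simp add: mult.commute)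
  also have "\<dots> \<le> 3 * (t\<^sup>2 / ?N) / ?N" using c2 n by (intro divide_right_mono mult_left_mono) auto
  also have "4 / (real s)\<^sup>2 \<le> 4 / (?N / (2 * t))\<^sup>2"
    using s3 s0 t n by (intro divide_left_mono power_mono mult_pos_pos zero_less_power) auto
  also have "3 * (t\<^sup>2 / ?N) / ?N + 4 / (?N / (2 * t))\<^sup>2 = 19 * t\<^sup>2 / ?N\<^sup>2"
    using t n by (simp add: field_simps power2_eq_square)
  finally show ?thesis by simp
qed

text \<open>As \<open>6859 = 19^3\<close> is the fixed point of \<open>t^3\<close> going to
  \<open>19 * t^2\<close>, only the power of \<open>2 * n\<close> changes from round to round. Round
  0 is the bound \<open>2 / n = 2 * n / n^2\<close>. A round leads from \<open>m\<close> to
  \<open>2 * m + 1\<close> terms. The assumption \<open>large\<close> is \<open>t^2 <= n\<close> for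
  the largest \<open>t\<close>, that of round 0.\<close>

lemma pmf_conv_pow_diff_prod_le_iterated:
  assumes n: "n \<ge> 2" and w: "inj_on w {1..n}" and v: "inj_on v {1..n}"
    and large: "361 * (2 * real n) powr (2/3) \<le> real n"
  shows "pmf (conv_pow (diff_prod_pmf n w v) (2 ^ Suc j - 1)) x \<le>
    6859 * (2 * real n) powr ((2/3) ^ j) / (real n)\<^sup>2"
proof (induction j arbitrary: x)
  case 0
  have "pmf (diff_prod_pmf n w v) x \<le> 2 / real n"
    using n by (intro pmf_diff_prod_le w v) auto
  also have "\<dots> = (2 * real n) / (real n)\<^sup>2" using n by (simp add: power2_eq_square)
  also have "\<dots> \<le> 6859 * (2 * real n) / (real n)\<^sup>2" by (intro divide_right_mono) auto
  finally show ?case using n by (simp add: conv_pow_Suc)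
next
  case (Suc j)
  let ?T = "diff_prod_pmf n w v" and ?m = "2 ^ Suc j - 1"
  define g where "g = (2 * real n) powr ((2/3) ^ j)"
  have le1: "(2/3::real) ^ j \<le> 1" by (intro power_le_one) auto
  have g1: "1 \<le> g" using n unfolding g_def by (intro ge_one_powr_ge_zero) auto
  have g2: "g \<le> 2 * real n" unfolding g_def using n powr_mono[OF le1, of "2 * real n"] by simp
  define t where "t = 19 * g powr (1/3)"
  have t3: "t ^ 3 = 6859 * g" and t2: "t\<^sup>2 = 361 * g powr (2/3)"
    using g1 by (simp_all add: t_def power_mult_distrib powr_power)
  have t1: "t \<ge> 1" using ge_one_powr_ge_zero[OF g1, of "1/3"] by (simp add: t_def)
  have "g powr (2/3) \<le> (2 * real n) powr (2/3)" using g1 g2 by (intro powr_mono2) auto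
  then have tn: "t\<^sup>2 \<le> real n" using large unfolding t2 by linarith
  have m: "2 ^ Suc (Suc j) - 1 = Suc (?m + ?m)"
  proof -
    have "(2::nat) ^ Suc (Suc j) = 2 ^ Suc j + 2 ^ Suc j" "(2::nat) ^ Suc j \<ge> 1" by simp_all
    then show ?thesis by linarith
  qed
  have IH: "pmf (conv_pow ?T ?m) y \<le> t ^ 3 / (real n)\<^sup>2" for y
    using Suc[of y] unfolding t3 g_def .
  have "pmf (conv_pow ?T (2 ^ Suc (Suc j) - 1)) x \<le> 19 * t\<^sup>2 / (real n)\<^sup>2"
    unfolding m conv_pow_Suc conv_pow_add
    by (rule pmf_diff_prod_conv_le) (use n w v t1 tn IH in auto)
  also have "19 * t\<^sup>2 = 6859 * (2 * real n) powr ((2/3) ^ Suc j)"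
    unfolding t2 g_def using n by (simp add: powr_powr mult.commute)
  finally show ?case .
qed

text \<open>Two rounds at least halve the exponent, since \<open>4/9 <= 1/2\<close>. After
  \<open>2 * i\<close> rounds it is at most \<open>1 / ln n\<close>, and
  \<open>(2 * n) powr (1 / ln n)\<close> is at most \<open>exp 2\<close>.\<close>

lemma pmf_conv_pow_diff_prod_le:
  assumes n: "n \<ge> 2" and w: "inj_on w {1..n}" and v: "inj_on v {1..n}"
    and large: "361 * (2 * real n) powr (2/3) \<le> real n"
    and i: "ln (real n) \<le> 2 ^ i" and d: "2 ^ Suc (2 * i) - 1 \<le> d"
  shows "pmf (conv_pow (diff_prod_pmf n w v) d) x \<le> 6859 * exp 2 / (real n)\<^sup>2"
proof (rule pmf_conv_pow_antimono[OF _ d])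
  fix y
  have ln0: "ln (real n) > 0" using n by simp
  have "(2/3 :: real) ^ (2 * i) = (4/9) ^ i" by (simp add: power_mult power2_eq_square)
  also have "\<dots> \<le> (1/2) ^ i" by (intro power_mono) auto
  also have "\<dots> = 1 / 2 ^ i" by (simp add: power_divide)
  also have "\<dots> \<le> 1 / ln (real n)" using i ln0 by (intro divide_left_mono) auto
  finally have e: "(2/3 :: real) ^ (2 * i) \<le> 1 / ln (real n)" .
  have "ln (2 * real n) \<le> 2 * ln (real n)" using n by (simp add: ln_mult)
  then have "(2/3) ^ (2 * i) * ln (2 * real n) \<le> 1 / ln (real n) * (2 * ln (real n))"
    using e n ln0 by (intro mult_mono) auto
  also have "\<dots> = 2" using ln0 by simp
  finally have "(2 * real n) powr ((2/3) ^ (2 * i)) \<le> exp 2" using n by (simp add: powr_def)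
  then have "6859 * (2 * real n) powr ((2/3) ^ (2 * i)) / (real n)\<^sup>2 \<le> 6859 * exp 2 / (real n)\<^sup>2"
    by (intro divide_right_mono mult_left_mono) auto
  then show "pmf (conv_pow (diff_prod_pmf n w v) (2 ^ Suc (2 * i) - 1)) y \<le> 6859 * exp 2 / (real n)\<^sup>2"
    using pmf_conv_pow_diff_prod_le_iterated[OF n w v large, of "2 * i" y] by linarith
qed (use n in auto)

section \<open>Collisions under random permutations\<close>

text \<open>Two such permutations differ by one that fixes \<open>P\<close> pointwise, so composing
  with the inverse of a chosen one injects them into the permutations of \<open>S - P\<close>. There
  may be none at all, as \<open>s\<close> need not be injective on \<open>P\<close>.\<close>

lemma card_permutes_fixing_le:
  assumes S: "finite S" and P: "P \<subseteq> S"
  shows "card {\<sigma>. \<sigma> permutes S \<and> (\<forall>i\<in>P. \<sigma> i = s i)} \<le> fact (card S - card P)"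
proof (cases "{\<sigma>. \<sigma> permutes S \<and> (\<forall>i\<in>P. \<sigma> i = s i)} = {}")
  case False
  then obtain \<sigma>0 where \<sigma>0: "\<sigma>0 permutes S" "\<forall>i\<in>P. \<sigma>0 i = s i" by blast
  have "card {\<sigma>. \<sigma> permutes S \<and> (\<forall>i\<in>P. \<sigma> i = s i)} \<le> card {\<tau>. \<tau> permutes S - P}"
  proof (rule card_inj_on_le[where f = "\<lambda>\<sigma>. inv \<sigma>0 \<circ> \<sigma>"])
    have "inj (inv \<sigma>0)" using permutes_inj[OF permutes_inv[OF \<sigma>0(1)]] .
    then show "inj_on (\<lambda>\<sigma>. inv \<sigma>0 \<circ> \<sigma>) {\<sigma>. \<sigma> permutes S \<and> (\<forall>i\<in>P. \<sigma> i = s i)}"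
      by (auto simp: inj_on_def fun_eq_iff)
    show "(\<lambda>\<sigma>. inv \<sigma>0 \<circ> \<sigma>) ` {\<sigma>. \<sigma> permutes S \<and> (\<forall>i\<in>P. \<sigma> i = s i)} \<subseteq> {\<tau>. \<tau> permutes S - P}"
    proof safe
      fix \<sigma> assume \<sigma>: "\<sigma> permutes S" "\<forall>i\<in>P. \<sigma> i = s i"
      show "inv \<sigma>0 \<circ> \<sigma> permutes S - P"
      proof (rule permutes_superset)
        show "inv \<sigma>0 \<circ> \<sigma> permutes S" using \<sigma>0(1) \<sigma>(1) by (intro permutes_compose permutes_inv)
        fix x assume "x \<in> S - (S - P)"
        then have "\<sigma> x = \<sigma>0 x" using \<sigma>0(2) \<sigma>(2) by auto
        then show "(inv \<sigma>0 \<circ> \<sigma>) x = x" using permutes_inverses(2)[OF \<sigma>0(1)] by simp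
      qed
    qed
    show "finite {\<tau>. \<tau> permutes S - P}" using S by (simp add: finite_permutations)
  qed
  also have "\<dots> = fact (card S - card P)"
    using S P by (intro card_permutations) (auto simp: card_Diff_subset finite_subset)
  finally show ?thesis .
next
  case True
  then show ?thesis by (simp only: card.empty)
qed

lemma fact_diff_mult_power_le: "p \<le> n \<Longrightarrow> fact (n - p) * (n - p) ^ p \<le> (fact n :: nat)"
proof (induction p)
  case (Suc p)
  obtain m where m: "n - p = Suc m" using Suc.prems by (cases "n - p") auto
  then have m': "n - Suc p = m" by simp
  have "fact m * m ^ Suc p = (fact m * m) * m ^ p" by simp
  also have "\<dots> \<le> (fact m * Suc m) * Suc m ^ p" by (intro mult_mono power_mono) auto
  also have "\<dots> = fact (n - p) * (n - p) ^ p" unfolding m by simp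
  also have "\<dots> \<le> fact n" using Suc by simp
  finally show ?case unfolding m' .
qed simp

text \<open>Few draws without replacement cost at most a factor 2 against independent draws: by
  Bernoulli's inequality \<open>(1 - p / n)^p >= 1 - p^2 / n >= 1/2\<close>.\<close>

lemma fact_diff_div_fact_le:
  assumes "2 * p\<^sup>2 \<le> n" "n > 0"
  shows "fact (n - p) / (fact n :: real) \<le> 2 / real n ^ p"
proof -
  have "p * 1 \<le> p\<^sup>2" unfolding power2_eq_square by (cases p) auto
  then have pn: "p \<le> n" using assms by linarith
  have "2 * real (p\<^sup>2) \<le> real n" using assms(1) by (metis of_nat_le_iff of_nat_mult of_nat_numeral)
  then have "real p * (real p / real n) \<le> 1 / 2" using assms(2) by (simp add: field_simps power2_eq_square)
  moreover have "1 + real p * (- (real p / real n)) \<le> (1 + (- (real p / real n))) ^ p"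
    using pn assms(2) by (intro Bernoulli_inequality) simp
  ultimately have "1 / 2 \<le> (1 - real p / real n) ^ p" by simp
  also have "1 - real p / real n = (real n - real p) / real n" using assms(2) by (simp add: field_simps)
  finally have half: "real n ^ p \<le> 2 * real (n - p) ^ p"
    using pn assms(2) by (simp add: power_divide field_simps of_nat_diff)
  have "real (fact (n - p) * (n - p) ^ p) \<le> real (fact n)"
    using fact_diff_mult_power_le[OF pn] by (simp only: of_nat_le_iff)
  then have "fact (n - p) * real (n - p) ^ p \<le> (fact n :: real)" by simp
  then have "fact (n - p) * (2 * real (n - p) ^ p) \<le> 2 * (fact n :: real)" by simp
  moreover have "fact (n - p) * real n ^ p \<le> fact (n - p) * (2 * real (n - p) ^ p)"
    using half by (intro mult_left_mono) auto
  ultimately have "fact (n - p) * real n ^ p \<le> 2 * (fact n :: real)" by linarith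
  then show ?thesis using assms(2) by (simp add: field_simps)
qed

lemma finite_perms: "finite {\<pi>. \<pi> permutes {1..n::nat}}"
  by (simp add: finite_permutations)

lemma perms_nonempty: "{\<pi>. \<pi> permutes {1..n::nat}} \<noteq> {}"
  using permutes_id by blast

lemma set_uniform_perm [simp]: "set_pmf (uniform_perm n) = {\<pi>. \<pi> permutes {1..n}}"
  unfolding uniform_perm_def by (rule set_pmf_of_set[OF perms_nonempty finite_perms])

lemma prob_perm_fiber_le:
  assumes "P \<subseteq> {1..n}" "2 * (card P)\<^sup>2 \<le> n" "n > 0"
  shows "measure_pmf.prob (uniform_perm n) {\<sigma>. \<forall>i\<in>P. \<sigma> i = s i} \<le> 2 / real n ^ card P"
proof -
  have "measure_pmf.prob (uniform_perm n) {\<sigma>. \<forall>i\<in>P. \<sigma> i = s i} =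
      real (card {\<sigma>. \<sigma> permutes {1..n} \<and> (\<forall>i\<in>P. \<sigma> i = s i)}) / real (card {\<pi>. \<pi> permutes {1..n}})"
    unfolding uniform_perm_def by (subst measure_pmf_of_set[OF perms_nonempty finite_perms]) (simp add: Int_def)
  also have "\<dots> \<le> real (fact (n - card P)) / real (fact n)"
  proof (intro frac_le)
    show "real (card {\<sigma>. \<sigma> permutes {1..n} \<and> (\<forall>i\<in>P. \<sigma> i = s i)}) \<le> real (fact (n - card P))"
      using card_permutes_fixing_le[OF _ assms(1), of s] unfolding of_nat_le_iff by simp
    show "real (fact n) \<le> real (card {\<pi>. \<pi> permutes {1..n}})"
      using card_permutations[of "{1..n}" n] by simp
  qed auto
  also have "\<dots> \<le> 2 / real n ^ card P" using fact_diff_div_fact_le[OF assms(2,3)] by simp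
  finally show ?thesis .
qed

lemma prob_le_of_pmf_le:
  assumes fin: "finite (set_pmf A)" and le: "\<And>q. pmf A q \<le> c * pmf B q" and c: "c \<ge> 0"
  shows "measure_pmf.prob A E \<le> c * measure_pmf.prob B E"
proof -
  have f: "finite (E \<inter> set_pmf A)" using fin by simp
  have "measure_pmf.prob A E = measure_pmf.prob A (E \<inter> set_pmf A)" by (simp add: measure_Int_set_pmf)
  also have "\<dots> = (\<Sum>q\<in>E \<inter> set_pmf A. pmf A q)" by (rule measure_measure_pmf_finite[OF f])
  also have "\<dots> \<le> c * (\<Sum>q\<in>E \<inter> set_pmf A. pmf B q)" unfolding sum_distrib_left by (intro sum_mono le)
  also have "(\<Sum>q\<in>E \<inter> set_pmf A. pmf B q) = measure_pmf.prob B (E \<inter> set_pmf A)"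
    by (rule measure_measure_pmf_finite[OF f, symmetric])
  also have "c * \<dots> \<le> c * measure_pmf.prob B E"
    using c by (intro mult_left_mono measure_pmf.finite_measure_mono) auto
  finally show ?thesis .
qed

lemma prob_pair_pmf_Times:
  "measure_pmf.prob (pair_pmf A B) {(a, b). a \<in> E \<and> b \<in> F} = measure_pmf.prob A E * measure_pmf.prob B F"
proof -
  have "measure_pmf.prob B {b. (a, b) \<in> {(a, b). a \<in> E \<and> b \<in> F}} = indicator E a * measure_pmf.prob B F" for a
    by (cases "a \<in> E") auto
  then show ?thesis by (simp add: prob_pair_pmf)
qed

section \<open>Comparison of random permutations with independent indices\<close>

definition quad_pmf :: "nat \<Rightarrow> ((nat \<times> nat) \<times> (nat \<times> nat)) pmf" where
  "quad_pmf n = pair_pmf (pair_pmf (pmf_of_set {1..n}) (pmf_of_set {1..n})) (pair_pmf (pmf_of_set {1..n}) (pmf_of_set {1..n}))"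

definition quad_at :: "(nat \<Rightarrow> nat) \<Rightarrow> (nat \<Rightarrow> nat) \<Rightarrow> nat \<Rightarrow> (nat \<times> nat) \<times> (nat \<times> nat)" where
  "quad_at \<sigma> \<rho> k = ((\<sigma> (2 * k + 1), \<sigma> (2 * k + 2)), (\<rho> (2 * k + 1), \<rho> (2 * k + 2)))"

definition quad_coef :: "(nat \<Rightarrow> real) \<Rightarrow> (nat \<Rightarrow> real) \<Rightarrow> (nat \<times> nat) \<times> (nat \<times> nat) \<Rightarrow> real" where
  "quad_coef w v = (\<lambda>((a, b), (c, d)). (w a - w b) * (v c - v d))"

lemma pmf_quad_pmf: "q \<in> ({1..n} \<times> {1..n}) \<times> ({1..n} \<times> {1..n}) \<Longrightarrow> pmf (quad_pmf n) q = 1 / real n ^ 4"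
  by (auto simp: quad_pmf_def pmf_pair pmf_of_set power4_eq_xxxx)

text \<open>The 4 is a factor 2 for each permutation. As \<open>D\<close> occupies
  \<open>2 * card D\<close> positions, \<open>8 * (card D)^2 <= n\<close> is the smallness condition
  of \<open>prob_perm_fiber_le\<close>. Being pointwise, the comparison passes to every
  event.\<close>

lemma pmf_quads_le:
  assumes D: "finite D" "\<And>k. k \<in> D \<Longrightarrow> 2 * k + 2 \<le> n" and size: "8 * (card D)\<^sup>2 \<le> n" and n: "n > 0"
  shows "pmf (map_pmf (\<lambda>(\<sigma>, \<rho>) k. if k \<in> D then quad_at \<sigma> \<rho> k else d) (pair_pmf (uniform_perm n) (uniform_perm n))) q
    \<le> 4 * pmf (Pi_pmf D d (\<lambda>_. quad_pmf n)) q"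
proof -
  let ?UU = "pair_pmf (uniform_perm n) (uniform_perm n)"
  let ?R = "\<lambda>(\<sigma>, \<rho>) k. if k \<in> D then quad_at \<sigma> \<rho> k else d"
  let ?Q = "({1..n} \<times> {1..n}) \<times> ({1..n} \<times> {1..n})"
  show ?thesis
  proof (cases "q \<in> PiE_dflt D d (\<lambda>_. ?Q)")
    case False
    have "q \<notin> set_pmf (map_pmf ?R ?UU)"
    proof
      assume "q \<in> set_pmf (map_pmf ?R ?UU)"
      then obtain \<sigma> \<rho> where s: "\<sigma> permutes {1..n}" "\<rho> permutes {1..n}" and q: "q = ?R (\<sigma>, \<rho>)" by auto
      have "quad_at \<sigma> \<rho> k \<in> ?Q" if "k \<in> D" for k
        using D(2)[OF that] permutes_in_seg[OF s(1)] permutes_in_seg[OF s(2)] unfolding quad_at_def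
        by auto
      then have "q \<in> PiE_dflt D d (\<lambda>_. ?Q)" unfolding q by (auto simp: PiE_dflt_def)
      with False show False ..
    qed
    then have "pmf (map_pmf ?R ?UU) q = 0" by (simp only: set_pmf_iff not_not)
    then show ?thesis by simp
  next
    case True
    define P where "P = (\<lambda>k. 2 * k + 1) ` D \<union> (\<lambda>k. 2 * k + 2) ` D"
    have cP: "card P = 2 * card D"
    proof -
      have "card P = card ((\<lambda>k. 2 * k + 1) ` D) + card ((\<lambda>k. 2 * k + 2) ` D)"
        unfolding P_def using D(1) by (intro card_Un_disjoint) (auto, presburger)
      then show ?thesis by (simp add: card_image inj_on_def)
    qed
    have Psub: "P \<subseteq> {1..n}" using D(2) by (fastforce simp: P_def)
    \<comment> \<open>Position \<open>i\<close> belongs to pair \<open>(i - 1) div 2\<close> and its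
      parity selects the component; \<open>s\<close> and \<open>t\<close> are the values that
      \<open>q\<close> prescribes to the two permutations.\<close>
    define s t where "s = (\<lambda>i. let x = fst (q ((i - 1) div 2)) in if odd i then fst x else snd x)"
      and "t = (\<lambda>i. let x = snd (q ((i - 1) div 2)) in if odd i then fst x else snd x)"
    have fib: "2 * (card P)\<^sup>2 \<le> n" using size by (simp add: cP power_mult_distrib)
    have "pmf (map_pmf ?R ?UU) q = measure_pmf.prob ?UU {x. ?R x = q}"
      by (simp add: pmf_map vimage_def)
    also have "\<dots> \<le> measure_pmf.prob ?UU {(\<sigma>, \<rho>). \<sigma> \<in> {\<sigma>. \<forall>i\<in>P. \<sigma> i = s i} \<and> \<rho> \<in> {\<rho>. \<forall>i\<in>P. \<rho> i = t i}}"
    proof (intro measure_pmf.finite_measure_mono)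
      show "{x. ?R x = q} \<subseteq> {(\<sigma>, \<rho>). \<sigma> \<in> {\<sigma>. \<forall>i\<in>P. \<sigma> i = s i} \<and> \<rho> \<in> {\<rho>. \<forall>i\<in>P. \<rho> i = t i}}"
        by (auto simp: P_def s_def t_def quad_at_def)
    qed simp
    also have "\<dots> \<le> (2 / real n ^ card P) * (2 / real n ^ card P)"
      unfolding prob_pair_pmf_Times using prob_perm_fiber_le[OF Psub fib n]
      by (intro mult_mono) auto
    also have "\<dots> = 4 * (1 / real n ^ 4) ^ card D"
      by (simp add: cP power_mult[symmetric] power_divide power_add[symmetric])
    also have "(1 / real n ^ 4) ^ card D = pmf (Pi_pmf D d (\<lambda>_. quad_pmf n)) q"
    proof -
      have "pmf (Pi_pmf D d (\<lambda>_. quad_pmf n)) q = (\<Prod>x\<in>D. pmf (quad_pmf n) (q x))"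
        using D True by (intro pmf_Pi') (auto simp: PiE_dflt_def)
      also have "\<dots> = (\<Prod>x\<in>D. 1 / real n ^ 4)"
        using True by (intro prod.cong refl pmf_quad_pmf) (auto simp: PiE_dflt_def)
      finally show ?thesis by simp
    qed
    finally show ?thesis .
  qed
qed

text \<open>Exchanging the first two indices flips the sign and preserves the law.\<close>

lemma map_quad_coef_uminus:
  "map_pmf (\<lambda>q. - quad_coef w v q) (quad_pmf n) = map_pmf (quad_coef w v) (quad_pmf n)"
proof -
  let ?U = "pmf_of_set {1..n}"
  have "pair_pmf ?U ?U = map_pmf (\<lambda>(a, b). (b, a)) (pair_pmf ?U ?U)"
    by (rule pair_commute_pmf)
  then have "quad_pmf n = map_pmf (apfst (\<lambda>(a, b). (b, a))) (quad_pmf n)"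
    unfolding quad_pmf_def by (metis pair_map_pmf1)
  then have "map_pmf (quad_coef w v) (quad_pmf n) = map_pmf (quad_coef w v) (map_pmf (apfst (\<lambda>(a, b). (b, a))) (quad_pmf n))"
    by simp
  also have "\<dots> = map_pmf (\<lambda>q. - quad_coef w v q) (quad_pmf n)"
    by (simp add: pmf.map_comp o_def quad_coef_def case_prod_unfold apfst_def map_prod_def)
       (simp add: algebra_simps)
  finally show ?thesis ..
qed

text \<open>Meant for the difference of two coin sums, where each coefficient carries a sign. After
  passing to independent quadruples the signs are absorbed by symmetry, which leaves a plain
  convolution power.\<close>

lemma prob_signed_sum_eq_0_le:
  assumes D: "finite D" "\<And>k. k \<in> D \<Longrightarrow> 2 * k + 2 \<le> n" and size: "8 * (card D)\<^sup>2 \<le> n" and n: "n > 0"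
    and e: "\<And>k. k \<in> D \<Longrightarrow> e k = 1 \<or> e k = (- 1 :: real)"
  shows "measure_pmf.prob (pair_pmf (uniform_perm n) (uniform_perm n))
      {(\<sigma>, \<rho>). (\<Sum>k\<in>D. e k * quad_coef w v (quad_at \<sigma> \<rho> k)) = 0}
    \<le> 4 * pmf (conv_pow (diff_prod_pmf n w v) (card D)) 0"
proof -
  let ?UU = "pair_pmf (uniform_perm n) (uniform_perm n)" and ?T = "diff_prod_pmf n w v"
  define d where "d = ((0::nat, 0::nat), (0::nat, 0::nat))"
  let ?R = "\<lambda>(\<sigma>, \<rho>) k. if k \<in> D then quad_at \<sigma> \<rho> k else d"
  let ?E = "{f. (\<Sum>k\<in>D. e k * quad_coef w v (f k)) = 0}"
  have "{(\<sigma>, \<rho>). (\<Sum>k\<in>D. e k * quad_coef w v (quad_at \<sigma> \<rho> k)) = 0} = ?R -` ?E"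
    by auto
  then have "measure_pmf.prob ?UU {(\<sigma>, \<rho>). (\<Sum>k\<in>D. e k * quad_coef w v (quad_at \<sigma> \<rho> k)) = 0} =
      measure_pmf.prob (map_pmf ?R ?UU) ?E"
    by simp
  also have "\<dots> \<le> 4 * measure_pmf.prob (Pi_pmf D d (\<lambda>_. quad_pmf n)) ?E"
    by (rule prob_le_of_pmf_le[OF _ pmf_quads_le[OF D size n]]) (auto simp: finite_permutations)
  also have "measure_pmf.prob (Pi_pmf D d (\<lambda>_. quad_pmf n)) ?E =
      pmf (map_pmf (\<lambda>f. \<Sum>k\<in>D. e k * quad_coef w v (f k)) (Pi_pmf D d (\<lambda>_. quad_pmf n))) 0"
    by (simp add: pmf_map vimage_def)
  also have "map_pmf (\<lambda>f. \<Sum>k\<in>D. e k * quad_coef w v (f k)) (Pi_pmf D d (\<lambda>_. quad_pmf n)) =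
      sum_pmf D (\<lambda>k. map_pmf (\<lambda>q. e k * quad_coef w v q) (quad_pmf n))"
    by (rule map_pmf_Pi_pmf_sum[OF D(1)])
  also have "\<dots> = sum_pmf D (\<lambda>_. ?T)"
  proof (rule sum_pmf_cong)
    fix k assume k: "k \<in> D"
    have T: "?T = map_pmf (quad_coef w v) (quad_pmf n)"
      by (simp add: diff_prod_pmf_def quad_coef_def quad_pmf_def)
    show "map_pmf (\<lambda>q. e k * quad_coef w v q) (quad_pmf n) = ?T"
      using e[OF k] map_quad_coef_uminus[of w v n] unfolding T by auto
  qed
  also have "\<dots> = conv_pow ?T (card D)" by (rule sum_pmf_const[OF D(1)])
  finally show ?thesis .
qed

lemma expectation_pair_pmf_finite:
  fixes f :: "'a \<times> 'b \<Rightarrow> real"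
  assumes "finite (set_pmf A)" "finite (set_pmf B)"
  shows "measure_pmf.expectation (pair_pmf A B) f =
    measure_pmf.expectation A (\<lambda>a. measure_pmf.expectation B (\<lambda>b. f (a, b)))"
  using assms
  by (auto simp: expectation_finite_pmf sum.cartesian_product pmf_pair sum_distrib_left mult.assoc intro!: sum.cong)

section \<open>Fair coins and collision probabilities\<close>

definition coin :: "bool pmf" where "coin = bernoulli_pmf (1 / 2)"

lemma finite_coin [simp]: "finite (set_pmf coin)"
  by (rule finite_subset[OF subset_UNIV]) simp

lemma pmf_coin [simp]: "pmf coin b = 1 / 2"
  by (cases b) (simp_all add: coin_def)

lemma expectation_coin: "measure_pmf.expectation coin (f :: bool \<Rightarrow> real) = (f True + f False) / 2"
proof -
  have "measure_pmf.expectation coin f = (\<Sum>b\<in>UNIV. pmf coin b * f b)"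
    by (subst integral_measure_pmf[of UNIV]) auto
  then show ?thesis by (simp add: UNIV_bool)
qed

definition coins :: "nat set \<Rightarrow> (nat \<Rightarrow> bool) pmf" where
  "coins I = Pi_pmf I False (\<lambda>_. coin)"

lemma finite_coins [simp]: "finite I \<Longrightarrow> finite (set_pmf (coins I))"
  unfolding coins_def by (subst set_Pi_pmf) (auto intro!: finite_PiE_dflt)

text \<open>Exponential moment for a Chernoff argument: two coin vectors rarely differ in only a few
  places. Each place contributes \<open>1/2 * 1 + 1/2 * 1/2 = 3/4\<close>.\<close>

lemma expectation_half_power_differing:
  assumes I: "finite I"
  shows "measure_pmf.expectation (pair_pmf (coins I) (coins I)) (\<lambda>(\<epsilon>, \<epsilon>'). (1/2) ^ card {k \<in> I. \<epsilon> k \<noteq> \<epsilon>' k})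
    = (3/4 :: real) ^ card I"
proof -
  have "measure_pmf.expectation (coins I) (\<lambda>\<epsilon>'. (1/2 :: real) ^ card {k \<in> I. \<epsilon> k \<noteq> \<epsilon>' k}) = (3/4) ^ card I" for \<epsilon> :: "nat \<Rightarrow> bool"
  proof -
    have "(1/2 :: real) ^ card {k \<in> I. \<epsilon> k \<noteq> \<epsilon>' k} = (\<Prod>k\<in>I. if \<epsilon> k \<noteq> \<epsilon>' k then 1/2 else 1)" for \<epsilon>' :: "nat \<Rightarrow> bool"
      using I by (simp add: prod.If_cases Int_def)
    then have "measure_pmf.expectation (coins I) (\<lambda>\<epsilon>'. (1/2 :: real) ^ card {k \<in> I. \<epsilon> k \<noteq> \<epsilon>' k}) =
        measure_pmf.expectation (coins I) (\<lambda>\<epsilon>'. \<Prod>k\<in>I. (\<lambda>b. if \<epsilon> k \<noteq> b then 1/2 else 1) (\<epsilon>' k))"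
      by simp
    also have "\<dots> = (\<Prod>k\<in>I. measure_pmf.expectation coin (\<lambda>b. if \<epsilon> k \<noteq> b then 1/2 else 1))"
      unfolding coins_def by (rule expectation_prod_Pi_pmf) (auto simp: I integrable_measure_pmf_finite)
    also have "\<dots> = (\<Prod>k\<in>I. 3/4)"
      by (intro prod.cong refl) (auto simp: expectation_coin)
    finally show ?thesis by simp
  qed
  then show ?thesis using I by (simp add: expectation_pair_pmf_finite)
qed

definition coin_term :: "real \<Rightarrow> real pmf" where
  "coin_term c = map_pmf (\<lambda>b. if b then c else 0) coin"

lemma finite_coin_term [simp]: "finite (set_pmf (coin_term c))"
  by (simp add: coin_term_def)

lemma pmf_coin_term_le: "c \<noteq> 0 \<Longrightarrow> pmf (coin_term c) x \<le> 1 / 2"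
proof -
  assume c: "c \<noteq> 0"
  have "(if b then c else 0) = x \<longrightarrow> b = (x = c)" for b using c by auto
  then have "measure_pmf.prob coin {b. (if b then c else 0) = x} \<le> measure_pmf.prob coin {x = c}"
    by (intro measure_pmf.finite_measure_mono) auto
  then show ?thesis by (simp add: coin_term_def pmf_map vimage_def measure_pmf_single)
qed

lemma sum_coin_term:
  "finite I \<Longrightarrow> sum_pmf I (\<lambda>k. coin_term (c k)) = map_pmf (\<lambda>\<epsilon>. \<Sum>k\<in>I. if \<epsilon> k then c k else 0) (coins I)"
  unfolding coins_def coin_term_def by (rule map_pmf_Pi_pmf_sum[symmetric])

definition collision :: "real pmf \<Rightarrow> real" where
  "collision A = measure_pmf.prob (pair_pmf A A) {(a, b). a = b}"

lemma collision_eq_sum: "finite (set_pmf A) \<Longrightarrow> collision A = (\<Sum>a\<in>set_pmf A. (pmf A a)\<^sup>2)"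
proof -
  assume "finite (set_pmf A)"
  moreover have "{b. (a, b) \<in> {(a, b). a = b}} = {a}" for a :: real by auto
  ultimately show ?thesis
    by (simp add: collision_def prob_pair_pmf measure_pmf_single expectation_finite_pmf power2_eq_square)
qed

text \<open>The inequality \<open>2 * p * q <= p^2 + q^2\<close> is used termwise. Unlike a product
  of square roots, the result is linear in the two collision probabilities and can be averaged over
  the permutations directly.\<close>

lemma pmf_conv_pmf_le_collision:
  assumes A: "finite (set_pmf A)" and B: "finite (set_pmf B)"
  shows "pmf (conv_pmf A B) x \<le> (collision A + collision B) / 2"
proof -
  have "pmf (conv_pmf A B) x = (\<Sum>a\<in>set_pmf A. pmf A a * pmf B (x - a))"
    by (simp add: pmf_conv_pmf expectation_finite_pmf A)
  also have "\<dots> \<le> (\<Sum>a\<in>set_pmf A. (pmf A a)\<^sup>2 / 2 + (pmf B (x - a))\<^sup>2 / 2)"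
  proof (rule sum_mono)
    fix a
    show "pmf A a * pmf B (x - a) \<le> (pmf A a)\<^sup>2 / 2 + (pmf B (x - a))\<^sup>2 / 2"
      using sum_squares_bound[of "pmf A a" "pmf B (x - a)"] by simp
  qed
  also have "\<dots> = collision A / 2 + (\<Sum>a\<in>set_pmf A. (pmf B (x - a))\<^sup>2) / 2"
    by (simp add: sum.distrib sum_divide_distrib collision_eq_sum A)
  also have "(\<Sum>a\<in>set_pmf A. (pmf B (x - a))\<^sup>2) = (\<Sum>b\<in>(\<lambda>a. x - a) ` set_pmf A. (pmf B b)\<^sup>2)"
    by (simp add: sum.reindex inj_on_def)
  also have "\<dots> \<le> (\<Sum>b\<in>(\<lambda>a. x - a) ` set_pmf A \<union> set_pmf B. (pmf B b)\<^sup>2)"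
    by (rule sum_mono2) (use A B in auto)
  also have "\<dots> = (\<Sum>b\<in>set_pmf B. (pmf B b)\<^sup>2)"
    by (rule sum.mono_neutral_right) (use A B in \<open>auto simp: set_pmf_iff\<close>)
  also have "\<dots> = collision B" by (simp add: collision_eq_sum B)
  finally show ?thesis by (simp add: add_divide_distrib)
qed

abbreviation pair_terms :: "(nat \<Rightarrow> real) \<Rightarrow> (nat \<Rightarrow> real) \<Rightarrow> (nat \<Rightarrow> nat) \<Rightarrow> (nat \<Rightarrow> nat) \<Rightarrow> nat \<Rightarrow> real pmf" where
  "pair_terms w v \<sigma> \<rho> k \<equiv> coin_term (quad_coef w v (quad_at \<sigma> \<rho> k))"

text \<open>For two fixed coin vectors a collision is the vanishing of a signed sum over the places
  where they differ. With at least \<open>r\<close> such places the atom bound gives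
  \<open>4 * a\<close>; with fewer, the trivial bound is paid for by the exponential moment.\<close>

lemma expectation_collision_le:
  assumes H: "finite H" "\<And>k. k \<in> H \<Longrightarrow> 2 * k + 2 \<le> n" and size: "8 * (card H)\<^sup>2 \<le> n" and n: "n > 0"
    and atom: "\<And>d. r \<le> d \<Longrightarrow> pmf (conv_pow (diff_prod_pmf n w v) d) 0 \<le> a"
  shows "measure_pmf.expectation (pair_pmf (uniform_perm n) (uniform_perm n))
      (\<lambda>(\<sigma>, \<rho>). collision (sum_pmf H (pair_terms w v \<sigma> \<rho>))) \<le> 4 * a + 2 ^ r * (3/4) ^ card H"
proof -
  let ?UU = "pair_pmf (uniform_perm n) (uniform_perm n)" and ?C = "pair_pmf (coins H) (coins H)"
  define S where "S = (\<lambda>(\<sigma>, \<rho>) \<epsilon>. \<Sum>k\<in>H. if \<epsilon> k then quad_coef w v (quad_at \<sigma> \<rho> k) else 0)"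
  define D where "D = (\<lambda>(\<epsilon>, \<epsilon>'). {k \<in> H. \<epsilon> k \<noteq> (\<epsilon>' k :: bool)})"
  have finUU: "finite (set_pmf ?UU)" by (simp add: finite_permutations)
  have finC: "finite (set_pmf ?C)" using H by simp
  have coll: "collision (sum_pmf H (pair_terms w v \<sigma> \<rho>)) = measure_pmf.prob ?C {z. S (\<sigma>, \<rho>) (fst z) = S (\<sigma>, \<rho>) (snd z)}" for \<sigma> \<rho>
    unfolding collision_def sum_coin_term[OF H(1)] S_def
    by (simp add: map_pair[symmetric] vimage_def case_prod_unfold cong: if_cong)
  have "measure_pmf.expectation ?UU (\<lambda>(\<sigma>, \<rho>). collision (sum_pmf H (pair_terms w v \<sigma> \<rho>))) =
      measure_pmf.expectation ?UU (\<lambda>s. measure_pmf.prob ?C {z. S s (fst z) = S s (snd z)})"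
    by (simp add: coll case_prod_unfold)
  also have "\<dots> = measure_pmf.expectation ?C (\<lambda>z. measure_pmf.prob ?UU {s. S s (fst z) = S s (snd z)})"
    by (rule expectation_prob_commute)
  also have "\<dots> \<le> measure_pmf.expectation ?C (\<lambda>z. 4 * a + 2 ^ r * (1/2) ^ card (D z))"
  proof (rule expectation_mono_pmf[OF finC])
    fix z :: "(nat \<Rightarrow> bool) \<times> (nat \<Rightarrow> bool)"
    obtain \<epsilon> \<epsilon>' where z: "z = (\<epsilon>, \<epsilon>')" by (cases z)
    have Dsub: "D z \<subseteq> H" by (auto simp: D_def z)
    have finD: "finite (D z)" using Dsub H(1) finite_subset by blast
    have cD: "card (D z) \<le> card H" using Dsub H(1) card_mono by blast
    have a0: "0 \<le> a" by (rule order_trans[OF pmf_nonneg atom[OF order_refl]])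
    show "measure_pmf.prob ?UU {s. S s (fst z) = S s (snd z)} \<le> 4 * a + 2 ^ r * (1/2) ^ card (D z)"
    proof (cases "r \<le> card (D z)")
      case True
      define e where "e = (\<lambda>k. if \<epsilon> k then 1 else - 1 :: real)"
      have diff: "S (\<sigma>, \<rho>) \<epsilon> - S (\<sigma>, \<rho>) \<epsilon>' = (\<Sum>k\<in>D z. e k * quad_coef w v (quad_at \<sigma> \<rho> k))" for \<sigma> \<rho>
      proof -
        have "S (\<sigma>, \<rho>) \<epsilon> - S (\<sigma>, \<rho>) \<epsilon>' = (\<Sum>k\<in>H. if \<epsilon> k \<noteq> \<epsilon>' k then e k * quad_coef w v (quad_at \<sigma> \<rho> k) else 0)"
          unfolding S_def e_def by (auto simp: sum_subtractf[symmetric] intro!: sum.cong)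
        also have "\<dots> = (\<Sum>k\<in>D z. e k * quad_coef w v (quad_at \<sigma> \<rho> k))"
          using H(1) by (simp add: D_def z sum.inter_filter)
        finally show ?thesis .
      qed
      have "S (\<sigma>, \<rho>) (fst z) = S (\<sigma>, \<rho>) (snd z) \<longleftrightarrow> (\<Sum>k\<in>D z. e k * quad_coef w v (quad_at \<sigma> \<rho> k)) = 0" for \<sigma> \<rho>
        unfolding z fst_conv snd_conv using diff[of \<sigma> \<rho>, unfolded z] by (metis eq_iff_diff_eq_0)
      then have "{s. S s (fst z) = S s (snd z)} = {(\<sigma>, \<rho>). (\<Sum>k\<in>D z. e k * quad_coef w v (quad_at \<sigma> \<rho> k)) = 0}"
        by auto
      then have "measure_pmf.prob ?UU {s. S s (fst z) = S s (snd z)} \<le> 4 * pmf (conv_pow (diff_prod_pmf n w v) (card (D z))) 0"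
      proof (simp only:, intro prob_signed_sum_eq_0_le finD n)
        show "8 * (card (D z))\<^sup>2 \<le> n" using power_mono[OF cD, of 2] size by linarith
        show "2 * k + 2 \<le> n" if "k \<in> D z" for k using that Dsub H(2) by blast
      qed (auto simp: e_def)
      also have "\<dots> \<le> 4 * a" using atom[OF True] by simp
      finally show ?thesis by (simp add: add_increasing2)
    next
      case False
      have "measure_pmf.prob ?UU {s. S s (fst z) = S s (snd z)} \<le> 1" by simp
      \<comment> \<open>The trivial bound is rewritten in terms of
        \<open>(1/2) ^ card (D z)\<close>, whose mean over the coins is
        \<open>(3/4) ^ card H\<close>.\<close>
      also have "(1::real) = 2 ^ card (D z) * (1/2) ^ card (D z)" by (simp add: power_divide)
      also have "\<dots> \<le> 2 ^ r * (1/2) ^ card (D z)"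
        using False by (intro mult_right_mono power_increasing) auto
      finally show ?thesis using a0 by simp
    qed
  qed
  also have "\<dots> = 4 * a + 2 ^ r * measure_pmf.expectation ?C (\<lambda>z. (1/2) ^ card (D z))"
    by (subst Bochner_Integration.integral_add) (auto simp: integrable_measure_pmf_finite[OF finC])
  also have "measure_pmf.expectation ?C (\<lambda>z. (1/2) ^ card (D z)) = (3/4 :: real) ^ card H"
    using expectation_half_power_differing[OF H(1)] by (simp add: D_def case_prod_unfold)
  finally show ?thesis .
qed

text \<open>Kesten's inequality needs a common atom bound, while only the average \<open>m\<close>
  of the \<open>q b\<close> is controlled. By Markov's inequality at least half of the indices have
  \<open>q b <= 2 * m\<close>; the others are dropped.\<close>

lemma pmf_sum_le_average_div_sqrt:
  assumes N: "N > 0" and fin: "\<And>b. b < N \<Longrightarrow> finite (set_pmf (X b))"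
    and half: "\<And>b x. b < N \<Longrightarrow> pmf (X b) x \<le> 1 / 2" and q: "\<And>b x. b < N \<Longrightarrow> pmf (X b) x \<le> q b"
  shows "pmf (sum_pmf {..<N} X) x \<le> 32 * ((\<Sum>b<N. q b) / real N) / sqrt (real N)"
proof -
  define m where "m = (\<Sum>b<N. q b) / real N"
  have q0: "q b > 0" if "b < N" for b
    using q[OF that] set_pmf_not_empty[of "X b"] by (meson less_le_trans pmf_positive ex_in_conv)
  have "(\<Sum>b<N. q b) > 0" using N q0 by (intro sum_pos) auto
  then have m0: "m > 0" using N by (simp add: m_def)
  define J where "J = {b \<in> {..<N}. q b \<le> 2 * m}"
  have finJ: "finite J" and Jsub: "J \<subseteq> {..<N}" by (auto simp: J_def)
  have "real (card ({..<N} - J)) * (2 * m) = (\<Sum>b\<in>{..<N} - J. 2 * m)" by simp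
  also have "\<dots> \<le> (\<Sum>b\<in>{..<N} - J. q b)" by (intro sum_mono) (auto simp: J_def)
  also have "\<dots> \<le> (\<Sum>b<N. q b)" using q0 by (intro sum_mono2) (auto intro: less_imp_le)
  also have "\<dots> = real N * m" using N by (simp add: m_def)
  finally have "2 * real (card ({..<N} - J)) \<le> real N" using m0 by simp
  then have Jbig: "real N \<le> 2 * real (card J)"
    using card_Diff_subset[OF finJ Jsub] card_mono[OF _ Jsub] by (simp add: of_nat_diff)
  then have neJ: "J \<noteq> {}" using N by auto
  \<comment> \<open>The cap 1/2, justified by the hypothesis \<open>half\<close>, ensures
    \<open>h >= 1\<close>. Rounding \<open>1 / (2 * Q)\<close> down to \<open>h\<close> then costs
    at most a factor 2.\<close>
  define Q where "Q = min (2 * m) (1 / 2)"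
  have Q: "0 < Q" "Q \<le> 1 / 2" "Q \<le> 2 * m" using m0 by (auto simp: Q_def)
  define h where "h = nat \<lfloor>1 / (2 * Q)\<rfloor>"
  have Q1: "1 / (2 * Q) \<ge> 1" using Q by simp
  have h: "h \<ge> 1" "real h \<le> 1 / (2 * Q)" "1 / (2 * Q) < real h + 1"
    using Q1 unfolding h_def by linarith+
  have h4: "1 / (4 * Q) \<le> real h" using h by (simp add: field_simps)
  have "pmf (sum_pmf J X) y \<le> 2 / (real h * sqrt (real (card J)))" for y
  proof (rule pmf_sum_le_atom_div_sqrt)
    fix b y assume b: "b \<in> J"
    have "pmf (X b) y \<le> Q" using half[of b y] q[of b y] b by (auto simp: Q_def J_def)
    also have "Q \<le> 1 / real (2 * h)" using h Q by (simp add: field_simps)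
    finally show "pmf (X b) y \<le> 1 / real (2 * h)" .
  qed (use h finJ neJ fin Jsub in auto)
  moreover have "2 / (real h * sqrt (real (card J))) \<le> 2 / (1 / (4 * Q) * (sqrt (real N) / 2))"
  proof (intro divide_left_mono mult_mono)
    have "real N \<le> 4 * real (card J)" using Jbig by simp
    then have "sqrt (real N) \<le> sqrt (4 * real (card J))" by (rule real_sqrt_le_mono)
    then show "sqrt (real N) / 2 \<le> sqrt (real (card J))" by (simp add: real_sqrt_mult)
    show "0 < real h * sqrt (real (card J)) * (1 / (4 * Q) * (sqrt (real N) / 2))"
      using h Q N finJ neJ by (intro mult_pos_pos) (auto simp: card_gt_0_iff)
  qed (use h4 Q in auto)
  moreover have "2 / (1 / (4 * Q) * (sqrt (real N) / 2)) = 16 * Q / sqrt (real N)" using Q by simp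
  moreover have "\<dots> \<le> 32 * m / sqrt (real N)" using Q N by (intro divide_right_mono) auto
  ultimately have J: "pmf (sum_pmf J X) y \<le> 32 * m / sqrt (real N)" for y by (smt (verit))
  have "{..<N} = ({..<N} - J) \<union> J" using Jsub by auto
  then have "sum_pmf {..<N} X = conv_pmf (sum_pmf ({..<N} - J) X) (sum_pmf J X)"
    using sum_pmf_Un[of "{..<N} - J" J X] finJ by auto
  then show ?thesis
    unfolding m_def[symmetric] using J fin by (auto intro!: pmf_conv_pmf_le finite_sum_pmf)
qed

section \<open>Random disjoint transpositions\<close>

text \<open>The random involution \<open>h\<close> of the overview: \<open>\<epsilon>\<close>
  selects the transpositions that take part.\<close>

definition swap_pairs :: "(nat \<Rightarrow> bool) \<Rightarrow> nat \<Rightarrow> nat" where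
  "swap_pairs \<epsilon> i = (if i > 0 \<and> \<epsilon> ((i - 1) div 2) then if odd i then i + 1 else i - 1 else i)"

lemma swap_pairs_odd: "swap_pairs \<epsilon> (2 * k + 1) = (if \<epsilon> k then 2 * k + 2 else 2 * k + 1)"
  and swap_pairs_even: "swap_pairs \<epsilon> (2 * k + 2) = (if \<epsilon> k then 2 * k + 1 else 2 * k + 2)"
  by (simp_all add: swap_pairs_def)

lemma pair_position_cases:
  obtains "i = 0" | k where "i = 2 * k + 1" | k where "i = 2 * k + (2::nat)"
proof (cases "odd i")
  case True
  then show ?thesis using that(2) oddE by blast
next
  case False
  then obtain k where "i = 2 * k" by blast
  then show ?thesis using that(1) that(3)[of "k - 1"] by (cases k) auto
qed

lemma swap_pairs_involution [simp]: "swap_pairs \<epsilon> (swap_pairs \<epsilon> i) = i"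
proof (cases i rule: pair_position_cases)
  case 1
  then show ?thesis by (simp add: swap_pairs_def)
next
  case (2 k)
  then show ?thesis using swap_pairs_odd[of \<epsilon> k] swap_pairs_even[of \<epsilon> k] by (simp split: if_splits)
next
  case (3 k)
  then show ?thesis using swap_pairs_odd[of \<epsilon> k] swap_pairs_even[of \<epsilon> k] by (simp split: if_splits)
qed

lemma swap_pairs_permutes:
  assumes "\<And>k. \<epsilon> k \<Longrightarrow> 2 * k + 2 \<le> n"
  shows "swap_pairs \<epsilon> permutes {1..n}"
proof (rule bij_imp_permutes)
  have "swap_pairs \<epsilon> i \<in> {1..n}" if "i \<in> {1..n}" for i
  proof (cases i rule: pair_position_cases)
    case (2 k)
    then show ?thesis using that assms[of k] swap_pairs_odd[of \<epsilon> k] by auto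
  next
    case (3 k)
    then show ?thesis using that assms[of k] swap_pairs_even[of \<epsilon> k] by auto
  qed (use that in auto)
  then show "bij_betw (swap_pairs \<epsilon>) {1..n} {1..n}"
    by (intro bij_betw_byWitness[where f' = "swap_pairs \<epsilon>"]) auto
  fix i assume i: "i \<notin> {1..n}"
  show "swap_pairs \<epsilon> i = i"
  proof (cases i rule: pair_position_cases)
    case 1
    then show ?thesis by (simp add: swap_pairs_def)
  next
    case (2 k)
    then show ?thesis using i assms[of k] swap_pairs_odd[of \<epsilon> k] by auto
  next
    case (3 k)
    then show ?thesis using i assms[of k] swap_pairs_even[of \<epsilon> k] by auto
  qed
qed

lemma sum_by_pairs:
  fixes M :: nat
  shows "(\<Sum>i=1..2 * M. F i) = (\<Sum>k<M. F (2 * k + 1) + F (2 * k + 2) :: real)"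
  by (induction M) (simp_all add: algebra_simps)

text \<open>Swapping one pair turns \<open>w a * v c + w b * v d\<close> into
  \<open>w a * v d + w b * v c\<close>, a loss of exactly
  \<open>(w a - w b) * (v c - v d)\<close>.\<close>

lemma sum_swap_pairs:
  fixes w v :: "nat \<Rightarrow> real"
  assumes M: "2 * M \<le> n" and \<epsilon>: "\<And>k. \<epsilon> k \<Longrightarrow> k < M"
  shows "(\<Sum>i=1..n. w (\<sigma> i) * v (\<rho> (swap_pairs \<epsilon> i))) =
    (\<Sum>i=1..n. w (\<sigma> i) * v (\<rho> i)) - (\<Sum>k<M. if \<epsilon> k then quad_coef w v (quad_at \<sigma> \<rho> k) else 0)"
proof -
  define F where "F = (\<lambda>i. w (\<sigma> i) * v (\<rho> (swap_pairs \<epsilon> i)) - w (\<sigma> i) * v (\<rho> i))"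
  have F0: "F i = 0" if "i \<in> {1..n} - {1..2 * M}" for i
  proof -
    have "\<not> \<epsilon> ((i - 1) div 2)" using \<epsilon>[of "(i - 1) div 2"] that by auto
    then show ?thesis by (simp add: F_def swap_pairs_def)
  qed
  have "(\<Sum>i=1..n. F i) = (\<Sum>i=1..2 * M. F i)"
    by (rule sum.mono_neutral_right) (use M F0 in auto)
  also have "\<dots> = (\<Sum>k<M. F (2 * k + 1) + F (2 * k + 2))" by (rule sum_by_pairs)
  also have "\<dots> = (\<Sum>k<M. - (if \<epsilon> k then quad_coef w v (quad_at \<sigma> \<rho> k) else 0))"
    unfolding F_def swap_pairs_odd swap_pairs_even
    by (intro sum.cong refl) (simp add: quad_coef_def quad_at_def algebra_simps)
  finally show ?thesis by (simp add: F_def sum_subtractf sum_negf)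
qed

lemma map_uniform_perm_compose:
  assumes "h permutes {1..n}"
  shows "map_pmf (\<lambda>\<rho>. \<rho> \<circ> h) (uniform_perm n) = uniform_perm n"
  unfolding uniform_perm_def
proof (rule map_pmf_of_set_bij_betw[OF _ perms_nonempty finite_perms])
  have 1: "h \<circ> inv h = id" "inv h \<circ> h = id" using permutes_inv_o[OF assms] by auto
  show "bij_betw (\<lambda>\<rho>. \<rho> \<circ> h) {\<pi>. \<pi> permutes {1..n}} {\<pi>. \<pi> permutes {1..n}}"
  proof (rule bij_betw_byWitness[where f' = "\<lambda>\<rho>. \<rho> \<circ> inv h"])
    show "(\<lambda>\<rho>. \<rho> \<circ> h) ` {\<pi>. \<pi> permutes {1..n}} \<subseteq> {\<pi>. \<pi> permutes {1..n}}"
      using permutes_compose[OF assms] by blast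
    show "(\<lambda>\<rho>. \<rho> \<circ> inv h) ` {\<pi>. \<pi> permutes {1..n}} \<subseteq> {\<pi>. \<pi> permutes {1..n}}"
      using permutes_compose[OF permutes_inv[OF assms]] by blast
  qed (simp_all add: comp_assoc 1)
qed

text \<open>For each fixed coin vector and each \<open>\<sigma>\<close>, reindexing turns the sum
  into the one for \<open>\<rho>\<close> composed with a fixed permutation, which is uniform like
  \<open>\<rho>\<close>. So the extra randomness changes nothing, and exchanging the averages leaves
  only the coins random inside.\<close>

lemma prob_perm_sum_eq_expectation:
  fixes w v :: "nat \<Rightarrow> real"
  assumes M: "2 * M \<le> n"
  shows "measure_pmf.prob (uniform_perm n) {\<pi>. (\<Sum>i=1..n. w i * v (\<pi> i)) = x} =
    measure_pmf.expectation (pair_pmf (uniform_perm n) (uniform_perm n))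
      (\<lambda>(\<sigma>, \<rho>). pmf (sum_pmf {..<M} (pair_terms w v \<sigma> \<rho>)) ((\<Sum>i=1..n. w (\<sigma> i) * v (\<rho> i)) - x))"
    (is "?p = _")
proof -
  let ?U = "uniform_perm n" and ?UU = "pair_pmf (uniform_perm n) (uniform_perm n)" and ?C = "coins {..<M}"
  define G where "G = (\<lambda>(\<sigma>, \<rho>) \<epsilon>. \<Sum>i=1..n. w (\<sigma> i) * v (\<rho> (swap_pairs \<epsilon> i)))"
  have supp: "k < M" if "\<epsilon> \<in> set_pmf ?C" "\<epsilon> k" for \<epsilon> k
    using that set_Pi_pmf_subset[of "{..<M}" False "\<lambda>_. coin"] unfolding coins_def by auto
  have const: "measure_pmf.prob ?UU {s. G s \<epsilon> = x} = ?p" if \<epsilon>: "\<epsilon> \<in> set_pmf ?C" for \<epsilon>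
  proof -
    have h: "swap_pairs \<epsilon> permutes {1..n}"
      using supp[OF \<epsilon>] M by (intro swap_pairs_permutes) fastforce
    have "measure_pmf.prob ?U {\<rho>. G (\<sigma>, \<rho>) \<epsilon> = x} = ?p" if \<sigma>: "\<sigma> permutes {1..n}" for \<sigma>
    proof -
      define h' where "h' = swap_pairs \<epsilon> \<circ> inv \<sigma>"
      have h': "h' permutes {1..n}" unfolding h'_def by (intro permutes_compose permutes_inv h \<sigma>)
      have "G (\<sigma>, \<rho>) \<epsilon> = (\<Sum>i=1..n. w i * v ((\<rho> \<circ> h') i))" for \<rho>
        using sum.permute[OF \<sigma>, of "\<lambda>i. w i * v ((\<rho> \<circ> h') i)"] permutes_inverses(2)[OF \<sigma>]
        by (simp add: G_def h'_def o_def)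
      then have "measure_pmf.prob ?U {\<rho>. G (\<sigma>, \<rho>) \<epsilon> = x} =
          measure_pmf.prob (map_pmf (\<lambda>\<rho>. \<rho> \<circ> h') ?U) {\<pi>. (\<Sum>i=1..n. w i * v (\<pi> i)) = x}"
        by (simp add: vimage_def)
      then show ?thesis by (simp add: map_uniform_perm_compose[OF h'])
    qed
    then have "measure_pmf.expectation ?U (\<lambda>\<sigma>. measure_pmf.prob ?U {\<rho>. G (\<sigma>, \<rho>) \<epsilon> = x}) =
        measure_pmf.expectation ?U (\<lambda>_. ?p)"
      by (intro integral_cong_AE) (auto simp: AE_measure_pmf_iff)
    then show ?thesis by (simp add: prob_pair_pmf)
  qed
  have "?p = measure_pmf.expectation ?C (\<lambda>\<epsilon>. measure_pmf.prob ?UU {s. G s \<epsilon> = x})"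
    using const by (subst integral_cong_AE[where g = "\<lambda>_. ?p"]) (auto simp: AE_measure_pmf_iff)
  also have "\<dots> = measure_pmf.expectation ?UU (\<lambda>s. measure_pmf.prob ?C {\<epsilon>. G s \<epsilon> = x})"
    by (rule expectation_prob_commute)
  also have "\<dots> = measure_pmf.expectation ?UU
      (\<lambda>(\<sigma>, \<rho>). pmf (sum_pmf {..<M} (pair_terms w v \<sigma> \<rho>)) ((\<Sum>i=1..n. w (\<sigma> i) * v (\<rho> i)) - x))"
  proof (intro arg_cong[where f = "measure_pmf.expectation ?UU"] ext)
    fix s :: "(nat \<Rightarrow> nat) \<times> (nat \<Rightarrow> nat)"
    obtain \<sigma> \<rho> where s: "s = (\<sigma>, \<rho>)" by (cases s)
    let ?S = "\<lambda>\<epsilon>. \<Sum>k<M. if \<epsilon> k then quad_coef w v (quad_at \<sigma> \<rho> k) else 0"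
    let ?c = "\<Sum>i=1..n. w (\<sigma> i) * v (\<rho> i)"
    have "measure_pmf.prob ?C {\<epsilon>. G s \<epsilon> = x} = measure_pmf.prob ?C ({\<epsilon>. G s \<epsilon> = x} \<inter> set_pmf ?C)"
      by (simp add: measure_Int_set_pmf)
    \<comment> \<open>The coins default to \<open>False\<close> outside \<open>{..<M}\<close>, so on
      their support every flipped pair fits into \<open>{1..n}\<close>; this is what
      \<open>sum_swap_pairs\<close> asks for.\<close>
    also have "{\<epsilon>. G s \<epsilon> = x} \<inter> set_pmf ?C = {\<epsilon>. ?S \<epsilon> = ?c - x} \<inter> set_pmf ?C"
    proof -
      have "G s \<epsilon> = ?c - ?S \<epsilon>" if "\<epsilon> \<in> set_pmf ?C" for \<epsilon>
        unfolding s G_def case_prod_conv by (rule sum_swap_pairs[OF M supp[OF that]])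
      then show ?thesis by auto
    qed
    also have "measure_pmf.prob ?C \<dots> = pmf (map_pmf ?S ?C) (?c - x)"
      by (simp add: measure_Int_set_pmf pmf_map vimage_def)
    also have "map_pmf ?S ?C = sum_pmf {..<M} (pair_terms w v \<sigma> \<rho>)"
      by (rule sum_coin_term[symmetric]) simp
    finally show "measure_pmf.prob ?C {\<epsilon>. G s \<epsilon> = x} = (case s of (\<sigma>, \<rho>) \<Rightarrow>
        pmf (sum_pmf {..<M} (pair_terms w v \<sigma> \<rho>)) ((\<Sum>i=1..n. w (\<sigma> i) * v (\<rho> i)) - x))"
      by (simp add: s)
  qed
  finally show ?thesis .
qed

section \<open>Cutting the coins into blocks and choosing the parameters\<close>

lemma sum_pmf_blocks:
  fixes N L :: nat
  assumes "L > 0"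
  shows "sum_pmf {..<N * L} Z = sum_pmf {..<N} (\<lambda>b. sum_pmf {b * L..<Suc b * L} Z)"
proof -
  have div: "x \<in> {b * L..<Suc b * L} \<longleftrightarrow> x div L = b" for x b
    using assms by (metis atLeastLessThan_iff div_nat_eqI div_mult_self_is_m dividend_less_div_times times_div_less_eq_dividend mult.commute add.commute mult_Suc)
  have "x \<in> {..<N * L} \<longleftrightarrow> x \<in> (\<Union>b<N. {b * L..<Suc b * L})" for x
  proof -
    have "x < N * L \<longleftrightarrow> x div L < N" using assms by (simp add: div_less_iff_less_mult)
    then show ?thesis unfolding UN_iff div by auto
  qed
  then have "{..<N * L} = (\<Union>b<N. {b * L..<Suc b * L})" by blast
  moreover have "disjoint_family_on (\<lambda>b. {b * L..<Suc b * L}) {..<N}"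
  proof -
    have "b = c" if "x \<in> {b * L..<Suc b * L}" "x \<in> {c * L..<Suc c * L}" for b c x
      using that unfolding div by simp
    then show ?thesis unfolding disjoint_family_on_def by blast
  qed
  ultimately show ?thesis by (simp add: sum_pmf_UN)
qed

text \<open>The \<open>2 * N\<close> half-blocks of length \<open>B\<close> are joined in pairs.
  Collisions of the halves bound the atoms of a block, and Kesten's inequality is applied to the
  \<open>N\<close> blocks through their average.\<close>

lemma pmf_coin_sum_le_collisions:
  assumes N: "N > 0" and B: "B > 0" and c: "\<And>k. k < 2 * N * B \<Longrightarrow> c k \<noteq> 0"
  shows "pmf (sum_pmf {..<2 * N * B} (\<lambda>k. coin_term (c k))) y
    \<le> 16 / (real N * sqrt (real N)) * (\<Sum>j<2 * N. collision (sum_pmf {j * B..<Suc j * B} (\<lambda>k. coin_term (c k))))"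
proof -
  let ?Z = "\<lambda>k. coin_term (c k)" and ?H = "\<lambda>j. {j * B..<Suc j * B}"
  let ?X = "\<lambda>b. conv_pmf (sum_pmf (?H (2 * b)) ?Z) (sum_pmf (?H (2 * b + 1)) ?Z)"
  let ?q = "\<lambda>b. (collision (sum_pmf (?H (2 * b)) ?Z) + collision (sum_pmf (?H (2 * b + 1)) ?Z)) / 2"
  have "sum_pmf {b * (2 * B)..<Suc b * (2 * B)} ?Z = ?X b" for b
  proof -
    have "{b * (2 * B)..<Suc b * (2 * B)} = ?H (2 * b) \<union> ?H (2 * b + 1)" by auto
    then show ?thesis by (subst sum_pmf_Un[symmetric]) auto
  qed
  then have eq: "sum_pmf {..<2 * N * B} ?Z = sum_pmf {..<N} ?X"
    using sum_pmf_blocks[of "2 * B" N ?Z] B by (simp add: mult_ac)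
  have "pmf (sum_pmf {..<2 * N * B} ?Z) y \<le> 32 * ((\<Sum>b<N. ?q b) / real N) / sqrt (real N)"
    unfolding eq
  proof (rule pmf_sum_le_average_div_sqrt[OF N])
    fix b z assume b: "b < N"
    show "finite (set_pmf (?X b))" by simp
    show "pmf (?X b) z \<le> ?q b" by (rule pmf_conv_pmf_le_collision) auto
    \<comment> \<open>A single fair coin with nonzero coefficient already caps the atoms of a block
      at 1/2; the first coin serves.\<close>
    have "Suc (2 * b) * B \<le> 2 * N * B" using b by (intro mult_le_mono) auto
    moreover have "2 * b * B < Suc (2 * b) * B" using B by simp
    ultimately have c0: "c (2 * b * B) \<noteq> 0" by (intro c) linarith
    have "?H (2 * b) = insert (2 * b * B) {Suc (2 * b * B)..<Suc (2 * b) * B}" using B by auto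
    then have "sum_pmf (?H (2 * b)) ?Z = conv_pmf (sum_pmf {Suc (2 * b * B)..<Suc (2 * b) * B} ?Z) (?Z (2 * b * B))"
      by (simp add: sum_pmf_insert conv_pmf_commute)
    then have "pmf (sum_pmf (?H (2 * b)) ?Z) z' \<le> 1 / 2" for z'
      by (simp only:) (intro pmf_conv_pmf_le pmf_coin_term_le c0, auto)
    then show "pmf (?X b) z \<le> 1 / 2"
      by (subst conv_pmf_commute) (intro pmf_conv_pmf_le, auto)
  qed
  also have "(\<Sum>b<N. ?q b) = (\<Sum>j<2 * N. collision (sum_pmf (?H j) ?Z)) / 2"
  proof -
    have "(\<Sum>b<N. f (2 * b) + f (2 * b + 1)) = (\<Sum>j<2 * N. f j)" for f :: "nat \<Rightarrow> real"
      by (induction N) simp_all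
    from this[of "\<lambda>j. collision (sum_pmf (?H j) ?Z)"] show ?thesis
      by (simp only: sum_divide_distrib[symmetric])
  qed
  finally show ?thesis by (simp add: mult_ac)
qed

lemma expectation_sum_pmf:
  fixes f :: "'i \<Rightarrow> 'a \<Rightarrow> real"
  assumes "finite (set_pmf A)"
  shows "measure_pmf.expectation A (\<lambda>a. \<Sum>i\<in>I. f i a) = (\<Sum>i\<in>I. measure_pmf.expectation A (f i))"
  by (rule Bochner_Integration.integral_sum) (use assms in \<open>auto intro: integrable_measure_pmf_finite\<close>)

text \<open>By linearity only the expected collision of one half-block at a time enters. Hence the
  comparison with independent indices concerns \<open>B\<close> pairs, which must be few against
  \<open>sqrt n\<close>, while all \<open>2 * N * B\<close> pairs together may fill the
  \<open>n\<close> positions.\<close>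

lemma prob_perm_sum_le:
  fixes w v :: "nat \<Rightarrow> real"
  assumes w: "inj_on w {1..n}" and v: "inj_on v {1..n}"
    and N: "N > 0" and B: "B > 0" and NB: "4 * N * B \<le> n" and size: "8 * B\<^sup>2 \<le> n"
    and atom: "\<And>d. r \<le> d \<Longrightarrow> pmf (conv_pow (diff_prod_pmf n w v) d) 0 \<le> a"
  shows "measure_pmf.prob (uniform_perm n) {\<pi>. (\<Sum>i=1..n. w i * v (\<pi> i)) = x}
    \<le> 32 / sqrt (real N) * (4 * a + 2 ^ r * (3/4) ^ B)"
proof -
  let ?UU = "pair_pmf (uniform_perm n) (uniform_perm n)" and ?H = "\<lambda>j. {j * B..<Suc j * B}"
  let ?e = "\<lambda>j s. case s of (\<sigma>, \<rho>) \<Rightarrow> collision (sum_pmf (?H j) (pair_terms w v \<sigma> \<rho>))"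
  have finUU: "finite (set_pmf ?UU)" by (simp add: finite_permutations)
  have n: "n > 0" using NB N B by (metis le_zero_eq mult_is_0 neq0_conv zero_neq_numeral)
  have "measure_pmf.prob (uniform_perm n) {\<pi>. (\<Sum>i=1..n. w i * v (\<pi> i)) = x} =
    measure_pmf.expectation ?UU (\<lambda>(\<sigma>, \<rho>). pmf (sum_pmf {..<2 * N * B} (pair_terms w v \<sigma> \<rho>))
       ((\<Sum>i=1..n. w (\<sigma> i) * v (\<rho> i)) - x))"
    by (rule prob_perm_sum_eq_expectation) (use NB in simp)
  also have "\<dots> \<le> measure_pmf.expectation ?UU (\<lambda>s. 16 / (real N * sqrt (real N)) * (\<Sum>j<2 * N. ?e j s))"
  proof (rule expectation_mono_pmf[OF finUU])
    fix s assume "s \<in> set_pmf ?UU"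
    then obtain \<sigma> \<rho> where s: "s = (\<sigma>, \<rho>)" and perm: "\<sigma> permutes {1..n}" "\<rho> permutes {1..n}" by auto
    have "quad_coef w v (quad_at \<sigma> \<rho> k) \<noteq> 0" if k: "k < 2 * N * B" for k
    proof -
      have pos: "2 * k + 1 \<in> {1..n}" "2 * k + 2 \<in> {1..n}" using k NB by auto
      have "u (\<tau> (2 * k + 1)) \<noteq> u (\<tau> (2 * k + 2))" if "inj_on u {1..n}" "\<tau> permutes {1..n}" for u :: "nat \<Rightarrow> real" and \<tau>
      proof
        assume "u (\<tau> (2 * k + 1)) = u (\<tau> (2 * k + 2))"
        then have "\<tau> (2 * k + 1) = \<tau> (2 * k + 2)"
          using inj_onD[OF that(1)] permutes_in_image[OF that(2)] pos by blast
        then show False using permutes_inj[OF that(2)] by (simp add: inj_eq)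
      qed
      from this[OF w perm(1)] this[OF v perm(2)] show ?thesis
        by (simp add: quad_coef_def quad_at_def)
    qed
    from pmf_coin_sum_le_collisions[OF N B, of "\<lambda>k. quad_coef w v (quad_at \<sigma> \<rho> k)", OF this]
    show "(case s of (\<sigma>, \<rho>) \<Rightarrow> pmf (sum_pmf {..<2 * N * B} (pair_terms w v \<sigma> \<rho>))
       ((\<Sum>i=1..n. w (\<sigma> i) * v (\<rho> i)) - x)) \<le> 16 / (real N * sqrt (real N)) * (\<Sum>j<2 * N. ?e j s)"
      by (simp add: s)
  qed
  also have "\<dots> = 16 / (real N * sqrt (real N)) * (\<Sum>j<2 * N. measure_pmf.expectation ?UU (?e j))"
    by (simp add: expectation_sum_pmf[OF finUU])
  also have "\<dots> \<le> 16 / (real N * sqrt (real N)) * (\<Sum>j<2 * N. 4 * a + 2 ^ r * (3/4) ^ B)"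
  proof (intro mult_left_mono sum_mono)
    fix j assume j: "j \<in> {..<2 * N}"
    have "2 * k + 2 \<le> n" if "k \<in> ?H j" for k
    proof -
      have "Suc j * B \<le> 2 * N * B" using j by (intro mult_le_mono) auto
      then show ?thesis using that NB by auto
    qed
    then show "measure_pmf.expectation ?UU (?e j) \<le> 4 * a + 2 ^ r * (3/4) ^ B"
      using expectation_collision_le[of "?H j" n r w v a] size n atom by simp
  qed auto
  also have "\<dots> = 32 / sqrt (real N) * (4 * a + 2 ^ r * (3/4) ^ B)" using N by simp
  finally show ?thesis .
qed

lemma prob_perm_sum_le_log:
  fixes w v :: "nat \<Rightarrow> real"
  assumes w: "inj_on w {1..n}" and v: "inj_on v {1..n}" and n: "n \<ge> 3"
    and large1: "361 * (2 * real n) powr (2/3) \<le> real n"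
    and large2: "8 * (88 * (ln (real n))\<^sup>2)\<^sup>2 \<le> real n"
  shows "measure_pmf.prob (uniform_perm n) {\<pi>. (\<Sum>i=1..n. w i * v (\<pi> i)) = x}
    \<le> 864 * (27436 * exp 2 + 1) * ln (real n) / real n powr (5/2)"
proof -
  define l where "l = ln (real n)"
  have l1: "l \<ge> 1"
  proof -
    have "exp 1 \<le> (3 :: real)" by (rule exp_le)
    also have "3 \<le> real n" using n by simp
    finally have "exp 1 \<le> real n" .
    then show ?thesis using n unfolding l_def by (subst ln_ge_iff) auto
  qed
  \<comment> \<open>This puts \<open>2 ^ i\<close> between \<open>l\<close> and
    \<open>2 * l\<close>, so the number \<open>r\<close> of terms required by the atom bound is of
    order \<open>l^2\<close>.\<close>
  define i where "i = nat \<lceil>log 2 l\<rceil>"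
  have logl: "log 2 l \<ge> 0" using l1 by simp
  have "log 2 l \<le> real i" "real i < log 2 l + 1" using logl unfolding i_def by linarith+
  then have "2 powr (log 2 l) \<le> 2 powr real i" "2 powr real i \<le> 2 powr (log 2 l + 1)" by simp_all
  then have i: "l \<le> 2 ^ i" "2 ^ i \<le> 2 * l" using l1 by (simp_all add: powr_realpow powr_add)
  define r :: nat where "r = 2 ^ Suc (2 * i) - 1"
  have r: "real r = 2 * (2 ^ i)\<^sup>2 - 1"
    by (simp add: r_def of_nat_diff power_mult[symmetric] power_even_eq mult.commute)
  have "1 \<le> (2 ^ i :: real)" by simp
  then have "(2 ^ i :: real) * 1 \<le> 2 ^ i * 2 ^ i" by (intro mult_left_mono) auto
  then have rl: "l \<le> real r" using i l1 unfolding r power2_eq_square by linarith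
  have "(2 ^ i :: real)\<^sup>2 \<le> (2 * l)\<^sup>2" using i by (intro power_mono) auto
  then have ru: "real r \<le> 8 * l\<^sup>2" unfolding r by (simp add: power_mult_distrib)
  have r0: "r > 0" using rl l1 by linarith
  \<comment> \<open>11 is the least factor with \<open>2 * (3/4) ^ 11 <= 1/9\<close>, and
    \<open>1/9 <= exp (- 2)\<close>. Since \<open>r >= l\<close>, the tail
    \<open>2 ^ r * (3/4) ^ B\<close> is then at most \<open>1 / n^2\<close>.\<close>
  define B where "B = 11 * r"
  have B0: "B > 0" using r0 by (simp add: B_def)
  have Bu: "real B \<le> 88 * l\<^sup>2" using ru by (simp add: B_def)
  have "8 * (real B)\<^sup>2 \<le> 8 * (88 * l\<^sup>2)\<^sup>2" using Bu by (intro mult_left_mono power_mono) auto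
  then have "real (8 * B\<^sup>2) \<le> real n" using large2 unfolding l_def by simp
  then have size: "8 * B\<^sup>2 \<le> n" by (simp only: of_nat_le_iff)
  define N where "N = n div (4 * B)"
  have "4 * B \<le> 8 * B\<^sup>2" using B0 by (cases B) (auto simp: power2_eq_square)
  then have Bn: "4 * B \<le> n" using size by (rule le_trans)
  then have N0: "N > 0" using B0 by (simp add: N_def div_greater_zero_iff)
  have NB: "4 * N * B \<le> n" using times_div_less_eq_dividend[of "4 * B" n] by (simp add: N_def mult_ac)
  have "n < Suc N * (4 * B)" unfolding N_def using dividend_less_times_div[of "4 * B" n] B0 by (simp add: mult_ac)
  also have "\<dots> \<le> (2 * N) * (4 * B)" using N0 by (intro mult_le_mono) auto
  finally have "real n < real ((2 * N) * (4 * B))" by (simp only: of_nat_less_iff)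
  then have "real n \<le> 8 * real N * real B" by simp
  also have "\<dots> \<le> 8 * real N * (88 * l\<^sup>2)" using Bu by (intro mult_left_mono) auto
  \<comment> \<open>\<open>8 * 88 = 704\<close> is rounded up to the square
    \<open>729 = 27^2\<close>; the later constant is \<open>864 = 32 * 27\<close>.\<close>
  also have "\<dots> \<le> 729 * l\<^sup>2 * real N" by simp
  finally have "sqrt (real n) \<le> sqrt ((27 * l)\<^sup>2 * real N)"
    by (intro real_sqrt_le_mono) (simp add: power_mult_distrib)
  \<comment> \<open>The factor \<open>l\<close> lost here, from blocks of length of order
    \<open>l^2\<close>, is the logarithm of the theorem.\<close>
  then have sN: "sqrt (real n) \<le> 27 * l * sqrt (real N)" using l1 by (simp add: real_sqrt_mult)
  have sn0: "sqrt (real n) > 0" "sqrt (real N) > 0" using n N0 by auto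
  have "2 ^ r * (3/4 :: real) ^ B = (2 * (3/4) ^ 11) ^ r"
    by (simp add: B_def power_mult power_mult_distrib)
  also have "\<dots> \<le> (1 / 9) ^ r" by (intro power_mono) (simp_all add: power_divide)
  also have "\<dots> \<le> exp (- 2) ^ r"
  proof (intro power_mono)
    have "exp (2::real) = exp 1 * exp 1" by (simp add: exp_add[symmetric])
    also have "\<dots> \<le> 3 * 3" using exp_le by (intro mult_mono) auto
    finally show "1 / 9 \<le> exp (- 2 :: real)" by (simp add: exp_minus field_simps)
  qed auto
  also have "\<dots> = exp (- (2 * real r))" by (simp add: exp_of_nat_mult[symmetric] mult.commute)
  also have "\<dots> \<le> exp (- (2 * l))" using rl by simp
  also have "\<dots> = 1 / (real n)\<^sup>2"
    using n by (simp add: l_def exp_minus exp_double field_simps)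
  finally have tail: "2 ^ r * (3/4 :: real) ^ B \<le> 1 / (real n)\<^sup>2" .
  have atom: "pmf (conv_pow (diff_prod_pmf n w v) d) 0 \<le> 6859 * exp 2 / (real n)\<^sup>2" if "r \<le> d" for d
    by (rule pmf_conv_pow_diff_prod_le[where i = i]) (use that n w v large1 i in \<open>auto simp: r_def l_def\<close>)
  have "measure_pmf.prob (uniform_perm n) {\<pi>. (\<Sum>i=1..n. w i * v (\<pi> i)) = x}
    \<le> 32 / sqrt (real N) * (4 * (6859 * exp 2 / (real n)\<^sup>2) + 2 ^ r * (3/4) ^ B)"
    by (rule prob_perm_sum_le[OF w v N0 B0 NB size atom])
  also have "\<dots> \<le> (864 * l / sqrt (real n)) * (4 * (6859 * exp 2 / (real n)\<^sup>2) + 1 / (real n)\<^sup>2)"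
  proof (intro mult_mono add_left_mono tail)
    show "32 / sqrt (real N) \<le> 864 * l / sqrt (real n)"
      using sN sn0 by (simp add: field_simps)
  qed (use l1 in auto)
  also have "\<dots> = 864 * (27436 * exp 2 + 1) * l / (sqrt (real n) * (real n)\<^sup>2)"
    using n by (simp add: field_simps)
  also have "sqrt (real n) * (real n)\<^sup>2 = real n powr (5/2)"
  proof -
    have "real n powr (5/2) = real n powr (1/2 + 2)" by simp
    also have "\<dots> = real n powr (1/2) * real n powr 2" by (rule powr_add)
    finally show ?thesis using n by (simp add: powr_half_sqrt powr_numeral)
  qed
  finally show ?thesis by (simp add: l_def)
qed

theorem corollary3p3:
  "\<exists>K::real. \<forall>n::nat. n \<ge> 2 \<longrightarrow>
     (\<forall>(w :: nat \<Rightarrow> real) (v :: nat \<Rightarrow> real).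
        inj_on w {1..n} \<longrightarrow> inj_on v {1..n} \<longrightarrow>
        (SUP x::real. measure_pmf.prob (uniform_perm n)
            {\<pi>. (\<Sum>i=1..n. w i * v (\<pi> i)) = x})
          \<le> K * ln (real n) / real n powr (5/2))"
proof -
  let ?K1 = "864 * (27436 * exp 2 + 1) :: real"
  have "eventually (\<lambda>n::nat. 361 * (2 * real n) powr (2/3) \<le> real n) at_top"
    by real_asymp
  moreover have "eventually (\<lambda>n::nat. 8 * (88 * (ln (real n))\<^sup>2)\<^sup>2 \<le> real n) at_top"
    by real_asymp
  ultimately have "eventually (\<lambda>n::nat. 361 * (2 * real n) powr (2/3) \<le> real n \<and>
      8 * (88 * (ln (real n))\<^sup>2)\<^sup>2 \<le> real n) at_top"
    by (rule eventually_conj)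
  then obtain n0 where n0: "361 * (2 * real n) powr (2/3) \<le> real n"
      "8 * (88 * (ln (real n))\<^sup>2)\<^sup>2 \<le> real n" if "n \<ge> n0" for n
    unfolding eventually_sequentially by blast
  \<comment> \<open>For \<open>n\<close> below the threshold the probability is only bounded by 1.
    \<open>K2\<close> makes the claimed bound at least 1 there, \<open>ln 2\<close> being the
    smallest value of \<open>ln n\<close>.\<close>
  define K2 where "K2 = real (max n0 3) powr (5/2) / ln 2"
  have bound: "measure_pmf.prob (uniform_perm n) {\<pi>. (\<Sum>i=1..n. w i * v (\<pi> i)) = x}
      \<le> max ?K1 K2 * ln (real n) / real n powr (5/2)"
    if n: "n \<ge> 2" and w: "inj_on w {1..n}" and v: "inj_on v {1..n}" for n x and w v :: "nat \<Rightarrow> real"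
  proof (cases "n \<ge> max n0 3")
    case True
    have "measure_pmf.prob (uniform_perm n) {\<pi>. (\<Sum>i=1..n. w i * v (\<pi> i)) = x}
        \<le> ?K1 * ln (real n) / real n powr (5/2)"
      by (rule prob_perm_sum_le_log[OF w v]) (use True n0[of n] in auto)
    also have "\<dots> \<le> max ?K1 K2 * ln (real n) / real n powr (5/2)"
      using n by (intro divide_right_mono mult_right_mono) auto
    finally show ?thesis .
  next
    case False
    have "real n powr (5/2) * ln 2 \<le> real (max n0 3) powr (5/2) * ln (real n)"
      using False n by (intro mult_mono powr_mono2) auto
    then have "1 \<le> K2 * ln (real n) / real n powr (5/2)"
      using n by (simp add: K2_def field_simps)
    also have "\<dots> \<le> max ?K1 K2 * ln (real n) / real n powr (5/2)"
      using n by (intro divide_right_mono mult_right_mono) auto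
    finally show ?thesis using measure_pmf.prob_le_1 order_trans by blast
  qed
  show ?thesis
    by (rule exI[of _ "max ?K1 K2"]) (intro allI impI cSUP_least bound, auto)
qed

end
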